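(* Let $X$ be a non-empty Lindelöf locally compact Hausdorff space, let $\mathcal{I}$ be a Riesz ideal and unital subalgebra of $C(X)$, and let $\Phi\colon\mathcal{I}\to\mathbb{R}$ be a positive linear map that is strictly $\mathcal{I}$-continuous. Let $\mathcal{I}_{\mathbb{C}}$ be the complexification of $\mathcal{I}$ and $\Phi_{\mathbb{C}}\colon\mathcal{I}_{\mathbb{C}}\to\mathbb{C}$ the complex linear extension of $\Phi$. Let $\mathcal{A}$ be a unital subalgebra of $\mathcal{I}$ that contains a point-separating subset $S$, and let $\mathcal{A}_{\mathbb{C}}\subseteq\mathcal{I}_{\mathbb{C}}$ be its complex linear span. Then the following are equivalent: (1) $\mathcal{A}_{\mathbb{C}}^{a\text{-cl}}=\mathcal{I}_{\mathbb{C}}$ for all $a\in S$. (2) For every $a\in S$ the symmetric operator $M_a$ in the GNS-representation of $\mathcal{A}_{\mathbb{C}}$ with respect to $\Phi_{\mathbb{C}}$ is essentially self-adjoint. If one, hence both, of these equivalent statements are true, then also $\mathcal{A}_{\mathbb{C}}^{\mathrm{cl}}=\mathcal{I}_{\mathbb{C}}$.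
   Context: $C(X)$ is the algebra of real-valued continuous functions on $X$ with pointwise operations and pointwise order. A Riesz ideal of $C(X)$ is a linear subspace $\mathcal{I}\subseteq C(X)$ such that $f\in C(X)$, $g\in\mathcal{I}$ and $|f|\le|g|$ (pointwise) imply $f\in\mathcal{I}$. A unital subalgebra is a linear subspace closed under multiplication and containing the constant function $1$. A linear map $\Phi\colon\mathcal{I}\to\mathbb{R}$ is positive if $\Phi(f)\ge 0$ for all $f\in\mathcal{I}$ with $f\ge0$; a positive linear $\Phi$ is strictly $\mathcal{I}$-continuous if $\inf_k\Phi(f_k)=0$ for every decreasing sequence $(f_k)_{k\in\mathbb{N}}$ in $\mathcal{I}$ with $\inf_kf_k(x)=0$ for all $x\in X$. A subset $S\subseteq C(X)$ is point-separating if for all $x\neq y$ in $X$ there is $s\in S$ with $s(x)\ne s(y)$. $\mathcal{I}_{\mathbb{C}}=\{f_r+\mathrm{i}f_i: f_r,f_i\in\mathcal{I}\}$, a commutative unital $^*$-algebra of complex-valued continuous functions on $X$ with pointwise complex conjugation as $^*$; $\mathcal{A}_{\mathbb{C}}$ is then a unital $^*$-subalgebra. On $\mathcal{I}_{\mathbb{C}}$ define $\langle f\,|\,g\rangle_\Phi=\Phi_{\mathbb{C}}(f^*g)$ and the seminorm $\|f\|_\Phi=\langle f\,|\,f\rangle_\Phi^{1/2}$. $\mathcal{A}_{\mathbb{C}}^{\mathrm{cl}}$ is the closure of $\mathcal{A}_{\mathbb{C}}$ in $\mathcal{I}_{\mathbb{C}}$ with respect to $\|\cdot\|_\Phi$.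 For $a=a^*\in\mathcal{A}_{\mathbb{C}}$, $\mathcal{A}_{\mathbb{C}}^{a\text{-cl}}$ is the closure of $\mathcal{A}_{\mathbb{C}}$ in $\mathcal{I}_{\mathbb{C}}$ with respect to the seminorm $g\mapsto(\|ag\|_\Phi^2+\|g\|_\Phi^2)^{1/2}$. GNS-representation: $\mathcal{G}_\Phi=\{a\in\mathcal{A}_{\mathbb{C}}:\|a\|_\Phi=0\}$ is a left ideal of $\mathcal{A}_{\mathbb{C}}$; the quotient $\mathcal{A}_{\mathbb{C}}/\mathcal{G}_\Phi$, with classes $[b]$, is a pre-Hilbert space with the inner product induced by $\langle\cdot|\cdot\rangle_\Phi$, and $\mathfrak{H}_\Phi$ is its Hilbert space completion. For $a\in\mathcal{A}_{\mathbb{C}}$, $M_a\colon\mathcal{A}_{\mathbb{C}}/\mathcal{G}_\Phi\to\mathcal{A}_{\mathbb{C}}/\mathcal{G}_\Phi$, $M_a[b]=[ab]$, viewed as a (possibly unbounded) operator on $\mathfrak{H}_\Phi$ with dense domain $\mathcal{A}_{\mathbb{C}}/\mathcal{G}_\Phi$; it is symmetric if $a=a^*$. Such a symmetric operator is essentially self-adjoint if the domain of its closure coincides with the domain of its Hilbert space adjoint. *)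

theory Defs
  imports "HOL-Analysis.Analysis"
begin

definition fun_subspace :: "('a \<Rightarrow> 'k::field) set \<Rightarrow> bool" where
  "fun_subspace V \<longleftrightarrow> (\<lambda>x. 0) \<in> V \<and> (\<forall>f\<in>V. \<forall>g\<in>V. (\<lambda>x. f x + g x) \<in> V)
     \<and> (\<forall>c. \<forall>f\<in>V. (\<lambda>x. c * f x) \<in> V)"

definition continuous_functions :: "('a::topological_space \<Rightarrow> real) set" where
  "continuous_functions = {f. continuous_on UNIV f}"

definition riesz_ideal :: "('a::topological_space \<Rightarrow> real) set \<Rightarrow> bool" where
  "riesz_ideal I \<longleftrightarrow> I \<subseteq> continuous_functions \<and> fun_subspace I
     \<and> (\<forall>f\<in>continuous_functions. \<forall>g\<in>I. (\<forall>x. \<bar>f x\<bar> \<le> \<bar>g x\<bar>) \<longrightarrow> f \<in> I)"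

definition unital_subalgebra :: "('a::topological_space \<Rightarrow> real) set \<Rightarrow> bool" where
  "unital_subalgebra A \<longleftrightarrow> A \<subseteq> continuous_functions \<and> fun_subspace A
     \<and> (\<lambda>x. 1) \<in> A \<and> (\<forall>f\<in>A. \<forall>g\<in>A. (\<lambda>x. f x * g x) \<in> A)"

definition point_separating :: "('a \<Rightarrow> real) set \<Rightarrow> bool" where
  "point_separating S \<longleftrightarrow> (\<forall>x y. x \<noteq> y \<longrightarrow> (\<exists>s\<in>S. s x \<noteq> s y))"

text \<open>Functionals on \<open>I\<close> are total functions of which only the values on \<open>I\<close> matter.\<close>

definition linear_functional_on ::
    "('a \<Rightarrow> real) set \<Rightarrow> (('a \<Rightarrow> real) \<Rightarrow> real) \<Rightarrow> bool" where
  "linear_functional_on I \<Phi> \<longleftrightarrow>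
     (\<forall>f\<in>I. \<forall>g\<in>I. \<Phi> (\<lambda>x. f x + g x) = \<Phi> f + \<Phi> g)
     \<and> (\<forall>c. \<forall>f\<in>I. \<Phi> (\<lambda>x. c * f x) = c * \<Phi> f)"

definition positive_linear_on ::
    "('a \<Rightarrow> real) set \<Rightarrow> (('a \<Rightarrow> real) \<Rightarrow> real) \<Rightarrow> bool" where
  "positive_linear_on I \<Phi> \<longleftrightarrow> linear_functional_on I \<Phi>
     \<and> (\<forall>f\<in>I. (\<forall>x. 0 \<le> f x) \<longrightarrow> 0 \<le> \<Phi> f)"

text \<open>The boundedness clause is needed because \<^const>\<open>Inf\<close> on \<^typ>\<open>real\<close> is unspecified
  for sets that are not bounded below.\<close>

definition has_inf :: "(nat \<Rightarrow> real) \<Rightarrow> real \<Rightarrow> bool" where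
  "has_inf u l \<longleftrightarrow> bdd_below (range u) \<and> (INF k. u k) = l"

definition strictly_continuous_on ::
    "('a \<Rightarrow> real) set \<Rightarrow> (('a \<Rightarrow> real) \<Rightarrow> real) \<Rightarrow> bool" where
  "strictly_continuous_on I \<Phi> \<longleftrightarrow>
     (\<forall>f :: nat \<Rightarrow> 'a \<Rightarrow> real. range f \<subseteq> I \<and> decseq f \<and> (\<forall>x. has_inf (\<lambda>k. f k x) 0)
        \<longrightarrow> has_inf (\<lambda>k. \<Phi> (f k)) 0)"

definition of_real_fun :: "('a \<Rightarrow> real) \<Rightarrow> 'a \<Rightarrow> complex" where
  "of_real_fun f = (\<lambda>x. complex_of_real (f x))"

definition complexification :: "('a \<Rightarrow> real) set \<Rightarrow> ('a \<Rightarrow> complex) set" where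
  "complexification I =
     {(\<lambda>x. of_real_fun fr x + \<i> * of_real_fun fi x) | fr fi. fr \<in> I \<and> fi \<in> I}"

definition complex_span :: "('a \<Rightarrow> real) set \<Rightarrow> ('a \<Rightarrow> complex) set" where
  "complex_span A = fun_subspace hull (of_real_fun ` A)"

definition complex_extension ::
    "(('a \<Rightarrow> real) \<Rightarrow> real) \<Rightarrow> ('a \<Rightarrow> complex) \<Rightarrow> complex" where
  "complex_extension \<Phi> f =
     complex_of_real (\<Phi> (\<lambda>x. Re (f x))) + \<i> * complex_of_real (\<Phi> (\<lambda>x. Im (f x)))"

definition inner_\<Phi> ::
    "(('a \<Rightarrow> real) \<Rightarrow> real) \<Rightarrow> ('a \<Rightarrow> complex) \<Rightarrow> ('a \<Rightarrow> complex) \<Rightarrow> complex" where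
  "inner_\<Phi> \<Phi> f g = complex_extension \<Phi> (\<lambda>x. cnj (f x) * g x)"

definition norm_\<Phi> :: "(('a \<Rightarrow> real) \<Rightarrow> real) \<Rightarrow> ('a \<Rightarrow> complex) \<Rightarrow> real" where
  "norm_\<Phi> \<Phi> f = sqrt (Re (inner_\<Phi> \<Phi> f f))"

definition graph_norm_\<Phi> ::
    "(('a \<Rightarrow> real) \<Rightarrow> real) \<Rightarrow> ('a \<Rightarrow> complex) \<Rightarrow> ('a \<Rightarrow> complex) \<Rightarrow> real" where
  "graph_norm_\<Phi> \<Phi> a g = sqrt ((norm_\<Phi> \<Phi> (\<lambda>x. a x * g x))\<^sup>2 + (norm_\<Phi> \<Phi> g)\<^sup>2)"

definition seminorm_closure ::
    "(('a \<Rightarrow> complex) \<Rightarrow> real) \<Rightarrow> ('a \<Rightarrow> complex) set \<Rightarrow> ('a \<Rightarrow> complex) set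
      \<Rightarrow> ('a \<Rightarrow> complex) set" where
  "seminorm_closure p V B = {f \<in> V. \<forall>\<epsilon>>0. \<exists>b\<in>B. p (\<lambda>x. f x - b x) < \<epsilon>}"

text \<open>The inner product is conjugate linear in its first argument.\<close>

record 'v ipspace =
  vecs :: "'v set"
  vadd :: "'v \<Rightarrow> 'v \<Rightarrow> 'v"
  vscale :: "complex \<Rightarrow> 'v \<Rightarrow> 'v"
  vinner :: "'v \<Rightarrow> 'v \<Rightarrow> complex"

definition vdiff :: "'v ipspace \<Rightarrow> 'v \<Rightarrow> 'v \<Rightarrow> 'v" where
  "vdiff V u v = vadd V u (vscale V (- 1) v)"

definition vnorm :: "'v ipspace \<Rightarrow> 'v \<Rightarrow> real" where
  "vnorm V v = sqrt (Re (vinner V v v))"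

definition vtendsto :: "'v ipspace \<Rightarrow> (nat \<Rightarrow> 'v) \<Rightarrow> 'v \<Rightarrow> bool" where
  "vtendsto V u v \<longleftrightarrow> (\<lambda>n. vnorm V (vdiff V (u n) v)) \<longlonglongrightarrow> 0"

definition cauchy_seqs :: "'v ipspace \<Rightarrow> (nat \<Rightarrow> 'v) set" where
  "cauchy_seqs V = {u. range u \<subseteq> vecs V \<and>
     (\<forall>\<epsilon>>0. \<exists>N. \<forall>m\<ge>N. \<forall>n\<ge>N. vnorm V (vdiff V (u m) (u n)) < \<epsilon>)}"

definition cauchy_rel :: "'v ipspace \<Rightarrow> ((nat \<Rightarrow> 'v) \<times> (nat \<Rightarrow> 'v)) set" where
  "cauchy_rel V = {(u, w). u \<in> cauchy_seqs V \<and> w \<in> cauchy_seqs V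
     \<and> (\<lambda>n. vnorm V (vdiff V (u n) (w n))) \<longlonglongrightarrow> 0}"

text \<open>The Hilbert space completion: Cauchy sequences modulo null sequences. As usual for
  quotients, operations are given by unions over all representatives; the union in the inner
  product is a singleton.\<close>

definition completion :: "'v ipspace \<Rightarrow> (nat \<Rightarrow> 'v) set ipspace" where
  "completion V = \<lparr>
     vecs = cauchy_seqs V // cauchy_rel V,
     vadd = (\<lambda>P Q. \<Union>u\<in>P. \<Union>w\<in>Q. cauchy_rel V `` {\<lambda>n. vadd V (u n) (w n)}),
     vscale = (\<lambda>c P. \<Union>u\<in>P. cauchy_rel V `` {\<lambda>n. vscale V c (u n)}),
     vinner = (\<lambda>P Q. the_elem (\<Union>u\<in>P. \<Union>w\<in>Q. {lim (\<lambda>n. vinner V (u n) (w n))})) \<rparr>"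

definition completion_embed :: "'v ipspace \<Rightarrow> 'v \<Rightarrow> (nat \<Rightarrow> 'v) set" where
  "completion_embed V v = cauchy_rel V `` {\<lambda>n. v}"

text \<open>An operator on a Hilbert space is represented by its graph, so that its domain is
  \<^const>\<open>Domain\<close>.\<close>

definition op_closure :: "'v ipspace \<Rightarrow> ('v \<times> 'v) set \<Rightarrow> ('v \<times> 'v) set" where
  "op_closure H T = {(u, v). u \<in> vecs H \<and> v \<in> vecs H \<and>
     (\<exists>s t. (\<forall>n. (s n, t n) \<in> T) \<and> vtendsto H s u \<and> vtendsto H t v)}"

definition op_adjoint :: "'v ipspace \<Rightarrow> ('v \<times> 'v) set \<Rightarrow> ('v \<times> 'v) set" where
  "op_adjoint H T = {(u, v). u \<in> vecs H \<and> v \<in> vecs H \<and>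
     (\<forall>(x, y)\<in>T. vinner H u y = vinner H v x)}"

text \<open>To be used for densely defined symmetric operators only.\<close>

definition essentially_selfadjoint :: "'v ipspace \<Rightarrow> ('v \<times> 'v) set \<Rightarrow> bool" where
  "essentially_selfadjoint H T \<longleftrightarrow> Domain (op_closure H T) = Domain (op_adjoint H T)"

definition gns_ideal ::
    "(('a \<Rightarrow> real) \<Rightarrow> real) \<Rightarrow> ('a \<Rightarrow> complex) set \<Rightarrow> ('a \<Rightarrow> complex) set" where
  "gns_ideal \<Phi> B = {b \<in> B. norm_\<Phi> \<Phi> b = 0}"

definition gns_rel ::
    "(('a \<Rightarrow> real) \<Rightarrow> real) \<Rightarrow> ('a \<Rightarrow> complex) set
      \<Rightarrow> (('a \<Rightarrow> complex) \<times> ('a \<Rightarrow> complex)) set" where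
  "gns_rel \<Phi> B = {(f, g). f \<in> B \<and> g \<in> B \<and> (\<lambda>x. f x - g x) \<in> gns_ideal \<Phi> B}"

definition gns_class ::
    "(('a \<Rightarrow> real) \<Rightarrow> real) \<Rightarrow> ('a \<Rightarrow> complex) set \<Rightarrow> ('a \<Rightarrow> complex)
      \<Rightarrow> ('a \<Rightarrow> complex) set" where
  "gns_class \<Phi> B b = gns_rel \<Phi> B `` {b}"

definition gns_quotient ::
    "(('a \<Rightarrow> real) \<Rightarrow> real) \<Rightarrow> ('a \<Rightarrow> complex) set \<Rightarrow> ('a \<Rightarrow> complex) set ipspace" where
  "gns_quotient \<Phi> B = \<lparr>
     vecs = B // gns_rel \<Phi> B,
     vadd = (\<lambda>P Q. \<Union>f\<in>P. \<Union>g\<in>Q. gns_class \<Phi> B (\<lambda>x. f x + g x)),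
     vscale = (\<lambda>c P. \<Union>f\<in>P. gns_class \<Phi> B (\<lambda>x. c * f x)),
     vinner = (\<lambda>P Q. the_elem (\<Union>f\<in>P. \<Union>g\<in>Q. {inner_\<Phi> \<Phi> f g})) \<rparr>"

definition gns_space ::
    "(('a \<Rightarrow> real) \<Rightarrow> real) \<Rightarrow> ('a \<Rightarrow> complex) set
      \<Rightarrow> (nat \<Rightarrow> ('a \<Rightarrow> complex) set) set ipspace" where
  "gns_space \<Phi> B = completion (gns_quotient \<Phi> B)"

definition gns_operator ::
    "(('a \<Rightarrow> real) \<Rightarrow> real) \<Rightarrow> ('a \<Rightarrow> complex) set \<Rightarrow> ('a \<Rightarrow> complex)
      \<Rightarrow> ((nat \<Rightarrow> ('a \<Rightarrow> complex) set) set \<times> (nat \<Rightarrow> ('a \<Rightarrow> complex) set) set) set" where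
  "gns_operator \<Phi> B a =
     {(completion_embed (gns_quotient \<Phi> B) (gns_class \<Phi> B b),
       completion_embed (gns_quotient \<Phi> B) (gns_class \<Phi> B (\<lambda>x. a x * b x))) | b. b \<in> B}"

end

theory Submission
  imports Defs
begin

text \<open>
  Write \<open>B\<close> for the complex span of \<open>A\<close>. The central notion is density, in the seminorm of \<open>\<Phi>\<close>, of
  the ranges \<open>(a + \<i>) B\<close> and \<open>(a - \<i>) B\<close> in \<open>B\<close>, for \<open>a\<close> in \<open>S\<close>.

  On the one hand, this is von Neumann's criterion for essential self-adjointness of \<open>M\<^sub>a\<close>
  (\<open>essentially_selfadjoint_iff_dense_range\<close>). Vectors of the GNS space are represented by Cauchy
  sequences in \<open>B\<close>, and the classical argument is carried out on such sequences: the orthogonal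
  projection to the closed range becomes a minimizing sequence, and a vector orthogonal to a dense
  subspace becomes a weakly null Cauchy sequence.

  On the other hand, the graph seminorm of \<open>a\<close> is \<open>f \<mapsto> \<parallel>(a \<plusminus> \<i>) f\<parallel>\<close>, and \<open>I\<close>, being an ideal, is
  stable under division by \<open>a \<plusminus> \<i>\<close>. So if \<open>B\<close> is dense in the complexification of \<open>I\<close> for the graph
  seminorm, then the ranges are dense. The converse holds as soon as \<open>B\<close> is dense in the
  complexification of \<open>I\<close> for the seminorm of \<open>\<Phi>\<close>.

  It remains to derive this last density, which is also the final claim, from density of the ranges
  for all \<open>a\<close> in \<open>S\<close>. The resolvents of the operators \<open>M\<^sub>a\<close> act on the closure \<open>N\<close> of \<open>B\<close> as
  multiplication by \<open>1 / (a \<plusminus> \<i>)\<close>. Hence \<open>N\<close> is a module over an algebra of bounded continuous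
  functions that separates points. As the space is Lindelof and locally compact, \<open>\<Phi>\<close> is
  concentrated on compact sets up to small mass (\<open>tight\<close>), and the Stone-Weierstrass theorem on
  these sets together with \<open>1 \<in> N\<close> yields every bounded function in \<open>I\<close>, hence all of \<open>I\<close>
  (\<open>N_eq_IC\<close>).
\<close>

section \<open>Semi-inner products on spaces of functions\<close>

locale semi_inner =
  fixes \<Phi> :: "(('a \<Rightarrow> real) \<Rightarrow> real)" and B :: "('a \<Rightarrow> complex) set"
  assumes subspace: "fun_subspace B"
    and inner_add_right: "\<lbrakk>f \<in> B; g \<in> B; h \<in> B\<rbrakk> \<Longrightarrow>
      inner_\<Phi> \<Phi> f (\<lambda>x. g x + h x) = inner_\<Phi> \<Phi> f g + inner_\<Phi> \<Phi> f h"
    and inner_scale_right: "\<lbrakk>f \<in> B; g \<in> B\<rbrakk> \<Longrightarrow>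
      inner_\<Phi> \<Phi> f (\<lambda>x. c * g x) = c * inner_\<Phi> \<Phi> f g"
    and inner_cnj: "\<lbrakk>f \<in> B; g \<in> B\<rbrakk> \<Longrightarrow> inner_\<Phi> \<Phi> g f = cnj (inner_\<Phi> \<Phi> f g)"
    and inner_pos: "f \<in> B \<Longrightarrow> 0 \<le> Re (inner_\<Phi> \<Phi> f f)"
begin

abbreviation ip :: "('a \<Rightarrow> complex) \<Rightarrow> ('a \<Rightarrow> complex) \<Rightarrow> complex"
  where "ip \<equiv> inner_\<Phi> \<Phi>"
abbreviation nm :: "('a \<Rightarrow> complex) \<Rightarrow> real"
  where "nm \<equiv> norm_\<Phi> \<Phi>"

lemma zero_mem: "(\<lambda>x. 0) \<in> B"
  and add_mem: "\<lbrakk>f \<in> B; g \<in> B\<rbrakk> \<Longrightarrow> (\<lambda>x. f x + g x) \<in> B"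
  and scale_mem: "f \<in> B \<Longrightarrow> (\<lambda>x. c * f x) \<in> B"
  using subspace unfolding fun_subspace_def by auto

lemma minus_mem: "f \<in> B \<Longrightarrow> (\<lambda>x. - f x) \<in> B"
  using scale_mem[of f "-1"] by simp

lemma diff_mem: "\<lbrakk>f \<in> B; g \<in> B\<rbrakk> \<Longrightarrow> (\<lambda>x. f x - g x) \<in> B"
  using add_mem[of f "\<lambda>x. - g x"] minus_mem[of g] by simp

lemmas mem = zero_mem add_mem scale_mem minus_mem diff_mem

lemma inner_minus_right: "\<lbrakk>f \<in> B; g \<in> B\<rbrakk> \<Longrightarrow> ip f (\<lambda>x. - g x) = - ip f g"
  using inner_scale_right[of f g "-1"] by simp

lemma inner_diff_right: "\<lbrakk>f \<in> B; g \<in> B; h \<in> B\<rbrakk> \<Longrightarrow> ip f (\<lambda>x. g x - h x) = ip f g - ip f h"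
  using inner_add_right[of f g "\<lambda>x. - h x"] inner_minus_right[of f h] by (simp add: mem)

lemma inner_add_left: "\<lbrakk>f \<in> B; g \<in> B; h \<in> B\<rbrakk> \<Longrightarrow> ip (\<lambda>x. f x + g x) h = ip f h + ip g h"
  by (simp add: inner_cnj[of h] inner_add_right mem)

lemma inner_diff_left: "\<lbrakk>f \<in> B; g \<in> B; h \<in> B\<rbrakk> \<Longrightarrow> ip (\<lambda>x. f x - g x) h = ip f h - ip g h"
  by (simp add: inner_cnj[of h] inner_diff_right mem)

lemma inner_scale_left: "\<lbrakk>f \<in> B; g \<in> B\<rbrakk> \<Longrightarrow> ip (\<lambda>x. c * f x) g = cnj c * ip f g"
  by (simp add: inner_cnj[of g] inner_scale_right mem)

lemma nm_ge0: "f \<in> B \<Longrightarrow> 0 \<le> nm f"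
  by (simp add: norm_\<Phi>_def inner_pos)

lemma nm_sq: "f \<in> B \<Longrightarrow> (nm f)\<^sup>2 = Re (ip f f)"
  by (simp add: norm_\<Phi>_def inner_pos)

text \<open>The expansion behind Cauchy-Schwarz, the triangle inequality, the parallelogram law and
  the minimization argument below, each for a suitable \<open>c\<close>.\<close>

lemma nm_sq_diff_scale:
  assumes "f \<in> B" "g \<in> B"
  shows "(nm (\<lambda>x. f x - c * g x))\<^sup>2 = (nm f)\<^sup>2 - 2 * Re (c * ip f g) + (cmod c)\<^sup>2 * (nm g)\<^sup>2"
proof -
  have "ip (\<lambda>x. f x - c * g x) (\<lambda>x. f x - c * g x) =
      ip f f - c * ip f g - cnj c * ip g f + c * cnj c * ip g g"
    using assms by (simp add: inner_diff_left inner_diff_right inner_scale_left inner_scale_right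
        mem algebra_simps)
  also have "cnj c * ip g f = cnj (c * ip f g)"
    using assms by (simp add: inner_cnj[of f g])
  also have "c * cnj c = complex_of_real ((cmod c)\<^sup>2)"
    by (rule complex_norm_square[symmetric])
  finally show ?thesis
    using assms by (simp add: nm_sq mem)
qed

lemma cauchy_schwarz:
  assumes "f \<in> B" "g \<in> B"
  shows "cmod (ip f g) \<le> nm f * nm g"
proof -
  have key: "0 \<le> (nm f)\<^sup>2 - 2 * t * (cmod (ip f g))\<^sup>2 + t\<^sup>2 * (cmod (ip f g))\<^sup>2 * (nm g)\<^sup>2" for t :: real
  proof -
    let ?c = "of_real t * cnj (ip f g)"
    have "?c * ip f g = complex_of_real (t * (cmod (ip f g))\<^sup>2)"
      using complex_norm_square[of "ip f g"] by (simp add: mult.commute)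
    then have "Re (?c * ip f g) = t * (cmod (ip f g))\<^sup>2" by (metis Re_complex_of_real)
    moreover have "(cmod ?c)\<^sup>2 = t\<^sup>2 * (cmod (ip f g))\<^sup>2"
      by (simp add: norm_mult power_mult_distrib)
    ultimately show ?thesis
      using nm_sq_diff_scale[OF assms, of ?c] zero_le_power2[of "nm (\<lambda>x. f x - ?c * g x)"]
      by simp
  qed
  have "(cmod (ip f g))\<^sup>2 \<le> (nm f * nm g)\<^sup>2"
  \<comment> \<open>If \<open>nm g = 0\<close>, the right side of \<open>key\<close> is affine in \<open>t\<close> and must be constant; otherwise
    \<open>t = 1 / (nm g)\<^sup>2\<close> is its minimum.\<close>
  proof (cases "nm g = 0")
    case True
    have "cmod (ip f g) = 0"
    proof (rule ccontr)
      assume nz: "cmod (ip f g) \<noteq> 0"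
      show False
        using key[of "((nm f)\<^sup>2 + 1) / (2 * (cmod (ip f g))\<^sup>2)"] nz True by (simp add: field_simps)
    qed
    then show ?thesis using True by simp
  next
    case False
    then have "0 < (nm g)\<^sup>2" by simp
    then have "t\<^sup>2 * u * (nm g)\<^sup>2 = t * u" if "t = 1 / (nm g)\<^sup>2" for t u
      using that by (simp add: power2_eq_square)
    from key[of "1 / (nm g)\<^sup>2"] this[OF refl, of "(cmod (ip f g))\<^sup>2"]
    have "(cmod (ip f g))\<^sup>2 / (nm g)\<^sup>2 \<le> (nm f)\<^sup>2" by simp
    then show ?thesis
      using \<open>0 < (nm g)\<^sup>2\<close> by (simp add: pos_divide_le_eq power_mult_distrib)
  qed
  then show ?thesis
    using power2_le_imp_le assms nm_ge0 by (metis mult_nonneg_nonneg)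
qed

lemma nm_scale: "f \<in> B \<Longrightarrow> nm (\<lambda>x. c * f x) = cmod c * nm f"
proof -
  assume f: "f \<in> B"
  have "ip (\<lambda>x. c * f x) (\<lambda>x. c * f x) = c * cnj c * ip f f"
    using f by (simp add: inner_scale_left inner_scale_right mem)
  also have "c * cnj c = complex_of_real ((cmod c)\<^sup>2)" by (rule complex_norm_square[symmetric])
  finally have "(nm (\<lambda>x. c * f x))\<^sup>2 = (cmod c * nm f)\<^sup>2"
    using f by (simp add: nm_sq mem power_mult_distrib)
  then show ?thesis using f by (simp add: nm_ge0 mem power2_eq_iff_nonneg)
qed

lemma nm_zero: "nm (\<lambda>x. 0) = 0"
  using nm_scale[of "\<lambda>x. 0" 0] zero_mem by simp

lemma nm_triangle:
  assumes "f \<in> B" "g \<in> B"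
  shows "nm (\<lambda>x. f x + g x) \<le> nm f + nm g"
proof -
  have "(nm (\<lambda>x. f x + g x))\<^sup>2 = (nm f)\<^sup>2 + 2 * Re (ip f g) + (nm g)\<^sup>2"
    using nm_sq_diff_scale[OF assms, of "-1"] by simp
  also have "\<dots> \<le> (nm f + nm g)\<^sup>2"
    using cauchy_schwarz[OF assms] complex_Re_le_cmod[of "ip f g"]
    by (simp add: power2_eq_square algebra_simps)
  finally show ?thesis
    using power2_le_imp_le assms nm_ge0 by (metis add_nonneg_nonneg)
qed

lemma nm_minus_commute: "\<lbrakk>f \<in> B; g \<in> B\<rbrakk> \<Longrightarrow> nm (\<lambda>x. f x - g x) = nm (\<lambda>x. g x - f x)"
  using nm_scale[of "\<lambda>x. f x - g x" "-1"] by (simp add: mem)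

lemma nm_diff_triangle:
  "\<lbrakk>f \<in> B; g \<in> B; h \<in> B\<rbrakk> \<Longrightarrow> nm (\<lambda>x. f x - h x) \<le> nm (\<lambda>x. f x - g x) + nm (\<lambda>x. g x - h x)"
  using nm_triangle[of "\<lambda>x. f x - g x" "\<lambda>x. g x - h x"] by (simp add: mem)

lemma nm_le_diff: "\<lbrakk>f \<in> B; g \<in> B\<rbrakk> \<Longrightarrow> nm f \<le> nm g + nm (\<lambda>x. f x - g x)"
  using nm_triangle[of g "\<lambda>x. f x - g x"] by (simp add: mem)

lemma nm_diff_abs: "\<lbrakk>f \<in> B; g \<in> B\<rbrakk> \<Longrightarrow> \<bar>nm f - nm g\<bar> \<le> nm (\<lambda>x. f x - g x)"
  using nm_le_diff[of f g] nm_le_diff[of g f] nm_minus_commute[of f g] by linarith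

definition cauchy :: "(nat \<Rightarrow> 'a \<Rightarrow> complex) \<Rightarrow> bool" where
  "cauchy f \<longleftrightarrow> (\<forall>n. f n \<in> B) \<and>
     (\<forall>\<epsilon>>0. \<exists>N. \<forall>m\<ge>N. \<forall>n\<ge>N. nm (\<lambda>x. f m x - f n x) < \<epsilon>)"

lemma cauchy_mem: "cauchy f \<Longrightarrow> f n \<in> B"
  by (simp add: cauchy_def)

lemma cauchy_const: "b \<in> B \<Longrightarrow> cauchy (\<lambda>n. b)"
  by (auto simp: cauchy_def nm_zero)

text \<open>Criterion for sequences of approximants: \<open>h\<close> is controlled by a sequence known to be
  Cauchy, up to errors \<open>e n\<close> made when \<open>h n\<close> was chosen by approximation.\<close>

lemma cauchyI_le:
  assumes f: "cauchy f" and h: "\<And>n. h n \<in> B" and C: "0 \<le> C"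
    and e: "e \<longlonglongrightarrow> 0"
    and le: "\<And>m n. nm (\<lambda>x. h m x - h n x) \<le> C * nm (\<lambda>x. f m x - f n x) + e m + e n"
  shows "cauchy h"
  unfolding cauchy_def
proof (intro conjI allI impI h)
  fix \<epsilon> :: real assume \<epsilon>: "0 < \<epsilon>"
  have "0 < \<epsilon> / (2 * (C + 1))" using \<epsilon> C by simp
  then obtain N1 where N1: "\<And>m n. m \<ge> N1 \<Longrightarrow> n \<ge> N1 \<Longrightarrow> nm (\<lambda>x. f m x - f n x) < \<epsilon> / (2 * (C + 1))"
    using f unfolding cauchy_def by meson
  obtain N2 where N2: "\<And>n. n \<ge> N2 \<Longrightarrow> \<bar>e n\<bar> < \<epsilon> / 4"
    using LIMSEQ_D[OF e, of "\<epsilon> / 4"] \<epsilon> by auto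
  show "\<exists>N. \<forall>m\<ge>N. \<forall>n\<ge>N. nm (\<lambda>x. h m x - h n x) < \<epsilon>"
  proof (intro exI allI impI)
    fix m n assume "max N1 N2 \<le> m" "max N1 N2 \<le> n"
    then have a: "nm (\<lambda>x. f m x - f n x) < \<epsilon> / (2 * (C + 1))" and b: "\<bar>e m\<bar> < \<epsilon> / 4" "\<bar>e n\<bar> < \<epsilon> / 4"
      using N1 N2 by auto
    have "C * nm (\<lambda>x. f m x - f n x) \<le> C * (\<epsilon> / (2 * (C + 1)))"
      using a C by (intro mult_left_mono) auto
    also have "\<dots> \<le> \<epsilon> / 2" using C \<epsilon> by (simp add: field_simps)
    finally show "nm (\<lambda>x. h m x - h n x) < \<epsilon>" using le[of m n] b by linarith
  qed
qed

lemma cauchy_scale: "cauchy f \<Longrightarrow> cauchy (\<lambda>n x. c * f n x)"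
proof (rule cauchyI_le[where e = "\<lambda>n. 0" and C = "cmod c" and f = f])
  fix m n assume f: "cauchy f"
  show "nm (\<lambda>x. c * f m x - c * f n x) \<le> cmod c * nm (\<lambda>x. f m x - f n x) + 0 + 0"
    using nm_scale[of "\<lambda>x. f m x - f n x" c] by (simp add: mem cauchy_mem[OF f] right_diff_distrib)
qed (auto simp: mem cauchy_mem)

lemma cauchy_add:
  assumes f: "cauchy f" and g: "cauchy g"
  shows "cauchy (\<lambda>n x. f n x + g n x)"
  unfolding cauchy_def
proof (intro conjI allI impI)
  fix \<epsilon> :: real assume "0 < \<epsilon>"
  then have "0 < \<epsilon> / 2" by simp
  then obtain N1 N2 where N1: "\<And>m n. m \<ge> N1 \<Longrightarrow> n \<ge> N1 \<Longrightarrow> nm (\<lambda>x. f m x - f n x) < \<epsilon> / 2"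
    and N2: "\<And>m n. m \<ge> N2 \<Longrightarrow> n \<ge> N2 \<Longrightarrow> nm (\<lambda>x. g m x - g n x) < \<epsilon> / 2"
    using f g unfolding cauchy_def by meson
  show "\<exists>N. \<forall>m\<ge>N. \<forall>n\<ge>N. nm (\<lambda>x. (f m x + g m x) - (f n x + g n x)) < \<epsilon>"
  proof (intro exI allI impI)
    fix m n assume "max N1 N2 \<le> m" "max N1 N2 \<le> n"
    then show "nm (\<lambda>x. (f m x + g m x) - (f n x + g n x)) < \<epsilon>"
      using nm_triangle[of "\<lambda>x. f m x - f n x" "\<lambda>x. g m x - g n x"] N1[of m n] N2[of m n]
      by (simp add: mem cauchy_mem f g algebra_simps)
  qed
qed (simp add: mem cauchy_mem f g)

lemma cauchy_diff: "\<lbrakk>cauchy f; cauchy g\<rbrakk> \<Longrightarrow> cauchy (\<lambda>n x. f n x - g n x)"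
  using cauchy_add[of f "\<lambda>n x. (-1) * g n x"] cauchy_scale[of g "-1"] by simp

lemma cauchy_nm_convergent:
  assumes f: "cauchy f" shows "convergent (\<lambda>n. nm (f n))"
proof -
  have "Cauchy (\<lambda>n. nm (f n))"
  proof (rule metric_CauchyI)
    fix e :: real assume "0 < e"
    then obtain N where "\<And>m n. m \<ge> N \<Longrightarrow> n \<ge> N \<Longrightarrow> nm (\<lambda>x. f m x - f n x) < e"
      using f unfolding cauchy_def by meson
    then show "\<exists>M. \<forall>m\<ge>M. \<forall>n\<ge>M. dist (nm (f m)) (nm (f n)) < e"
      using nm_diff_abs cauchy_mem[OF f] unfolding dist_real_def by (meson le_less_trans)
  qed
  then show ?thesis by (simp add: Cauchy_convergent_iff)
qed

lemma cauchy_bounded: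
  assumes "cauchy f" obtains K where "0 < K" "\<And>n. nm (f n) \<le> K"
proof -
  obtain K where "K > 0" "\<And>n. norm (nm (f n)) \<le> K"
    using convergent_imp_Bseq[OF cauchy_nm_convergent[OF assms]] by (auto elim: BseqE)
  then show thesis using that[of K] by (metis abs_le_D1 real_norm_def)
qed

lemma inner_tendsto_zero:
  assumes f: "\<And>n. f n \<in> B" and "(\<lambda>n. nm (f n)) \<longlonglongrightarrow> 0" and g: "cauchy g"
  shows "(\<lambda>n. ip (f n) (g n)) \<longlonglongrightarrow> 0"
proof -
  obtain K where K: "0 < K" "\<And>n. nm (g n) \<le> K" using cauchy_bounded[OF g] by blast
  have "norm (ip (f n) (g n)) \<le> nm (f n) * K" for n
    using cauchy_schwarz[OF f cauchy_mem[OF g], of n n] K(2)[of n] nm_ge0[OF f, of n]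
    by (meson mult_left_mono order_trans)
  moreover have "(\<lambda>n. nm (f n) * K) \<longlonglongrightarrow> 0" using assms(2) tendsto_mult_left_zero by blast
  ultimately show ?thesis by (rule Lim_null_comparison[OF always_eventually[OF allI]])
qed

lemma cauchy_inner_convergent:
  assumes f: "cauchy f" and g: "cauchy g"
  shows "convergent (\<lambda>n. ip (f n) (g n))"
proof -
  obtain K where K: "0 < K" "\<And>n. nm (g n) \<le> K" using cauchy_bounded[OF g] by blast
  obtain L where L: "0 < L" "\<And>n. nm (f n) \<le> L" using cauchy_bounded[OF f] by blast
  have "Cauchy (\<lambda>n. ip (f n) (g n))"
  proof (rule metric_CauchyI)
    fix e :: real assume "0 < e"
    then have e: "0 < e / (2 * K)" "0 < e / (2 * L)" using K L by auto
    obtain N1 where N1: "\<And>m n. m \<ge> N1 \<Longrightarrow> n \<ge> N1 \<Longrightarrow> nm (\<lambda>x. f m x - f n x) < e / (2 * K)"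
      using f e unfolding cauchy_def by meson
    obtain N2 where N2: "\<And>m n. m \<ge> N2 \<Longrightarrow> n \<ge> N2 \<Longrightarrow> nm (\<lambda>x. g m x - g n x) < e / (2 * L)"
      using g e unfolding cauchy_def by meson
    show "\<exists>M. \<forall>m\<ge>M. \<forall>n\<ge>M. dist (ip (f m) (g m)) (ip (f n) (g n)) < e"
    proof (intro exI allI impI)
      fix m n assume "max N1 N2 \<le> m" "max N1 N2 \<le> n"
      then have a: "nm (\<lambda>x. f m x - f n x) < e / (2 * K)" and b: "nm (\<lambda>x. g m x - g n x) < e / (2 * L)"
        using N1 N2 by auto
      have "ip (f m) (g m) - ip (f n) (g n) =
          ip (\<lambda>x. f m x - f n x) (g m) + ip (f n) (\<lambda>x. g m x - g n x)"
        by (simp add: inner_diff_left inner_diff_right cauchy_mem f g)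
      then have "dist (ip (f m) (g m)) (ip (f n) (g n)) \<le>
          cmod (ip (\<lambda>x. f m x - f n x) (g m)) + cmod (ip (f n) (\<lambda>x. g m x - g n x))"
        by (simp add: dist_norm norm_triangle_ineq)
      also have "\<dots> \<le> nm (\<lambda>x. f m x - f n x) * nm (g m) + nm (f n) * nm (\<lambda>x. g m x - g n x)"
        by (intro add_mono cauchy_schwarz mem cauchy_mem f g)
      also have "\<dots> \<le> nm (\<lambda>x. f m x - f n x) * K + L * nm (\<lambda>x. g m x - g n x)"
        by (intro add_mono mult_left_mono mult_right_mono K L nm_ge0 mem cauchy_mem f g)
      also have "\<dots> < e / (2 * K) * K + L * (e / (2 * L))"
        using a b K L by (intro add_strict_mono mult_strict_right_mono mult_strict_left_mono) auto
      also have "\<dots> = e" using K L by simp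
      finally show "dist (ip (f m) (g m)) (ip (f n) (g n)) < e" .
    qed
  qed
  then show ?thesis by (simp add: Cauchy_convergent_iff)
qed

lemma cauchy_inner_lim:
  "\<lbrakk>cauchy f; cauchy g\<rbrakk> \<Longrightarrow> (\<lambda>n. ip (f n) (g n)) \<longlonglongrightarrow> lim (\<lambda>n. ip (f n) (g n))"
  using cauchy_inner_convergent convergent_LIMSEQ_iff by blast

text \<open>Weak and strong limits of a Cauchy sequence agree. With \<open>N\<close> large and fixed,
  \<open>ip (w n) (w n)\<close> differs little from \<open>ip (w n) (w N)\<close>, to which the weak hypothesis applies.
  This plays the part of the fact that only \<open>0\<close> is orthogonal to a dense subspace of the
  completion.\<close>

lemma weakly_null_cauchy:
  assumes w: "cauchy w" and weak: "\<And>c. c \<in> B \<Longrightarrow> (\<lambda>n. ip (w n) c) \<longlonglongrightarrow> 0"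
  shows "(\<lambda>n. nm (w n)) \<longlonglongrightarrow> 0"
proof -
  obtain K where K: "0 < K" "\<And>n. nm (w n) \<le> K" using cauchy_bounded[OF w] by blast
  have "(\<lambda>n. (nm (w n))\<^sup>2) \<longlonglongrightarrow> 0"
  proof (rule LIMSEQ_I)
    fix r :: real assume r: "0 < r"
    then have "0 < r / (2 * K)" using K by simp
    then obtain N where N: "\<And>m n. m \<ge> N \<Longrightarrow> n \<ge> N \<Longrightarrow> nm (\<lambda>x. w m x - w n x) < r / (2 * K)"
      using w unfolding cauchy_def by meson
    obtain N' where N': "\<And>n. n \<ge> N' \<Longrightarrow> norm (ip (w n) (w N)) < r / 2"
      using LIMSEQ_D[OF weak[OF cauchy_mem[OF w]], of "r/2" N] r by auto
    show "\<exists>no. \<forall>n\<ge>no. norm ((nm (w n))\<^sup>2 - 0) < r"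
    proof (intro exI allI impI)
      fix n assume n: "max N N' \<le> n"
      have "ip (w n) (w n) = ip (w n) (w N) + ip (w n) (\<lambda>x. w n x - w N x)"
        by (simp add: inner_diff_right cauchy_mem w)
      then have "(nm (w n))\<^sup>2 \<le> cmod (ip (w n) (w N)) + cmod (ip (w n) (\<lambda>x. w n x - w N x))"
        using nm_sq[OF cauchy_mem[OF w], of n] by (metis complex_Re_le_cmod norm_triangle_ineq order_trans)
      also have "cmod (ip (w n) (\<lambda>x. w n x - w N x)) \<le> nm (w n) * nm (\<lambda>x. w n x - w N x)"
        by (intro cauchy_schwarz mem cauchy_mem w)
      also have "\<dots> \<le> K * nm (\<lambda>x. w n x - w N x)"
        by (intro mult_right_mono K nm_ge0 mem cauchy_mem w)
      also have "\<dots> \<le> K * (r / (2 * K))"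
        using N[of n N] n K by (intro mult_left_mono) auto
      also have "\<dots> = r / 2" using K by simp
      finally show "norm ((nm (w n))\<^sup>2 - 0) < r" using N'[of n] n by simp
    qed
  qed
  then have "(\<lambda>n. sqrt ((nm (w n))\<^sup>2)) \<longlonglongrightarrow> sqrt 0" by (rule tendsto_real_sqrt)
  then show ?thesis using nm_ge0[OF cauchy_mem[OF w]] by simp
qed

end

section \<open>The GNS space in terms of Cauchy sequences\<close>

context semi_inner
begin

abbreviation V where "V \<equiv> gns_quotient \<Phi> B"
abbreviation H where "H \<equiv> gns_space \<Phi> B"
abbreviation cls where "cls \<equiv> gns_class \<Phi> B"

lemma cls_iff: "f \<in> B \<Longrightarrow> g \<in> cls f \<longleftrightarrow> g \<in> B \<and> nm (\<lambda>x. f x - g x) = 0"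
  by (auto simp: gns_class_def gns_rel_def gns_ideal_def mem)

lemma cls_self: "f \<in> B \<Longrightarrow> f \<in> cls f"
  by (simp add: cls_iff nm_zero)

lemma cls_eq_iff:
  assumes "f \<in> B" "g \<in> B" shows "cls f = cls g \<longleftrightarrow> nm (\<lambda>x. f x - g x) = 0"
proof
  assume "cls f = cls g" then show "nm (\<lambda>x. f x - g x) = 0"
    using cls_self[of g] assms cls_iff by blast
next
  assume z: "nm (\<lambda>x. f x - g x) = 0"
  have "h \<in> cls f \<longleftrightarrow> h \<in> cls g" for h
  proof (cases "h \<in> B")
    case True
    then show ?thesis
      using nm_diff_triangle[of f g h] nm_diff_triangle[of g f h] nm_minus_commute[of f g] z assms
        nm_ge0[of "\<lambda>x. f x - h x"] nm_ge0[of "\<lambda>x. g x - h x"]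
      by (auto simp: cls_iff mem)
  qed (use assms cls_iff in blast)
  then show "cls f = cls g" by blast
qed

lemma vecs_V: "vecs V = cls ` B"
  by (auto simp: gns_quotient_def quotient_def gns_class_def)

lemma vadd_V:
  assumes "f \<in> B" "g \<in> B" shows "vadd V (cls f) (cls g) = cls (\<lambda>x. f x + g x)"
proof -
  have "cls (\<lambda>x. f' x + g' x) = cls (\<lambda>x. f x + g x)" if "f' \<in> cls f" "g' \<in> cls g" for f' g'
  proof -
    have m: "f' \<in> B" "g' \<in> B" and z: "nm (\<lambda>x. f x - f' x) = 0" "nm (\<lambda>x. g x - g' x) = 0"
      using that assms cls_iff by auto
    have "nm (\<lambda>x. (f x - f' x) + (g x - g' x)) \<le> 0"
      using nm_triangle[of "\<lambda>x. f x - f' x" "\<lambda>x. g x - g' x"] z m assms by (simp add: mem)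
    moreover have "(\<lambda>x. (f x - f' x) + (g x - g' x)) = (\<lambda>x. (f x + g x) - (f' x + g' x))" by auto
    ultimately have "nm (\<lambda>x. (f x + g x) - (f' x + g' x)) = 0"
      using nm_ge0[of "\<lambda>x. (f x + g x) - (f' x + g' x)"] m assms by (simp add: mem)
    then show ?thesis using m assms by (subst eq_commute) (simp add: cls_eq_iff mem)
  qed
  then have "(\<Union>f'\<in>cls f. \<Union>g'\<in>cls g. cls (\<lambda>x. f' x + g' x)) = cls (\<lambda>x. f x + g x)"
    using cls_self assms by blast
  then show ?thesis by (simp add: gns_quotient_def)
qed

lemma vscale_V:
  assumes "f \<in> B" shows "vscale V c (cls f) = cls (\<lambda>x. c * f x)"
proof -
  have "cls (\<lambda>x. c * f' x) = cls (\<lambda>x. c * f x)" if "f' \<in> cls f" for f'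
  proof -
    have m: "f' \<in> B" and z: "nm (\<lambda>x. f x - f' x) = 0"
      using that assms cls_iff by auto
    have "nm (\<lambda>x. c * f x - c * f' x) = 0"
      using nm_scale[of "\<lambda>x. f x - f' x" c] z m assms by (simp add: mem right_diff_distrib)
    then show ?thesis using m assms by (subst eq_commute) (simp add: cls_eq_iff mem)
  qed
  then have "(\<Union>f'\<in>cls f. cls (\<lambda>x. c * f' x)) = cls (\<lambda>x. c * f x)"
    using cls_self assms by blast
  then show ?thesis by (simp add: gns_quotient_def)
qed

lemma vinner_V:
  assumes "f \<in> B" "g \<in> B" shows "vinner V (cls f) (cls g) = ip f g"
proof -
  have "ip f' g' = ip f g" if "f' \<in> cls f" "g' \<in> cls g" for f' g'
  proof -
    have m: "f' \<in> B" "g' \<in> B" and z: "nm (\<lambda>x. f x - f' x) = 0" "nm (\<lambda>x. g x - g' x) = 0"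
      using that assms cls_iff by auto
    have "ip (\<lambda>x. f x - f' x) g = 0" "ip f' (\<lambda>x. g x - g' x) = 0"
      using cauchy_schwarz[of "\<lambda>x. f x - f' x" g] cauchy_schwarz[of f' "\<lambda>x. g x - g' x"] z m assms
      by (simp_all add: mem)
    then show ?thesis using m assms by (simp add: inner_diff_left inner_diff_right)
  qed
  then have "(\<Union>f'\<in>cls f. \<Union>g'\<in>cls g. {ip f' g'}) = {ip f g}"
    using cls_self assms by blast
  then show ?thesis by (simp add: gns_quotient_def)
qed

lemma vnorm_V: "f \<in> B \<Longrightarrow> vnorm V (cls f) = nm f"
  by (simp add: vnorm_def vinner_V norm_\<Phi>_def)

lemma vdiff_V: "f \<in> B \<Longrightarrow> g \<in> B \<Longrightarrow> vdiff V (cls f) (cls g) = cls (\<lambda>x. f x - g x)"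
  by (simp add: vdiff_def vadd_V vscale_V mem)

abbreviation lift where "lift f \<equiv> \<lambda>n. cls (f n)"

lemma cauchy_seqs_V: "cauchy_seqs V = lift ` {f. cauchy f}"
proof -
  have "lift f \<in> cauchy_seqs V \<longleftrightarrow> cauchy f" if "\<And>n. f n \<in> B" for f
    using that by (auto simp: cauchy_seqs_def cauchy_def vecs_V vdiff_V vnorm_V mem)
  moreover have "\<exists>f. (\<forall>n. f n \<in> B) \<and> u = lift f" if "u \<in> cauchy_seqs V" for u
  proof -
    have "\<forall>n. \<exists>g\<in>B. u n = cls g" 
    proof
      fix n
      have "u n \<in> cls ` B" using that vecs_V by (auto simp: cauchy_seqs_def)
      then show "\<exists>g\<in>B. u n = cls g" by blast
    qed
    then show ?thesis by metis
  qed
  ultimately show ?thesis using cauchy_mem by blast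
qed

lemma cauchy_rel_lift:
  assumes "cauchy f" "cauchy g"
  shows "(lift f, lift g) \<in> cauchy_rel V \<longleftrightarrow> (\<lambda>n. nm (\<lambda>x. f n x - g n x)) \<longlonglongrightarrow> 0"
  using assms by (auto simp: cauchy_rel_def cauchy_seqs_V vdiff_V vnorm_V mem cauchy_mem)

text \<open>Vectors of the completion are denoted by Cauchy sequences of functions in \<open>B\<close>. This hides both
  quotients, and turns every later statement about the Hilbert space into one about limits of
  semi-inner products of functions.\<close>

definition hvec :: "(nat \<Rightarrow> 'a \<Rightarrow> complex) \<Rightarrow> (nat \<Rightarrow> ('a \<Rightarrow> complex) set) set" where
  "hvec f = cauchy_rel V `` {lift f}"

lemma vecs_H: "vecs H = hvec ` {f. cauchy f}"
  by (auto simp: gns_space_def completion_def quotient_def hvec_def cauchy_seqs_V)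

lemma mem_vec:
  assumes "cauchy f"
  shows "w \<in> hvec f \<longleftrightarrow> (\<exists>g. cauchy g \<and> w = lift g \<and> (\<lambda>n. nm (\<lambda>x. f n x - g n x)) \<longlonglongrightarrow> 0)"
proof
  assume w: "w \<in> hvec f"
  then have "w \<in> cauchy_seqs V" by (auto simp: hvec_def cauchy_rel_def)
  then obtain g where "cauchy g" "w = lift g" by (auto simp: cauchy_seqs_V)
  with w show "\<exists>g. cauchy g \<and> w = lift g \<and> (\<lambda>n. nm (\<lambda>x. f n x - g n x)) \<longlonglongrightarrow> 0"
    using cauchy_rel_lift[OF assms] by (auto simp: hvec_def)
qed (use cauchy_rel_lift[OF assms] in \<open>auto simp: hvec_def\<close>)

lemma lift_mem_vec: "cauchy f \<Longrightarrow> lift f \<in> hvec f"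
  by (auto simp: mem_vec nm_zero intro!: exI[of _ f])

lemma null_diff_trans:
  assumes "cauchy f" "cauchy g" "cauchy h"
    and "(\<lambda>n. nm (\<lambda>x. f n x - g n x)) \<longlonglongrightarrow> 0" "(\<lambda>n. nm (\<lambda>x. g n x - h n x)) \<longlonglongrightarrow> 0"
  shows "(\<lambda>n. nm (\<lambda>x. f n x - h n x)) \<longlonglongrightarrow> 0"
proof (rule Lim_null_comparison)
  show "\<forall>\<^sub>F n in sequentially. norm (nm (\<lambda>x. f n x - h n x))
      \<le> nm (\<lambda>x. f n x - g n x) + nm (\<lambda>x. g n x - h n x)"
    using assms(1-3) by (simp add: nm_diff_triangle nm_ge0 mem cauchy_mem)
  show "(\<lambda>n. nm (\<lambda>x. f n x - g n x) + nm (\<lambda>x. g n x - h n x)) \<longlonglongrightarrow> 0"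
    using tendsto_add[OF assms(4,5)] by simp
qed

lemma vec_eq_iff:
  assumes f: "cauchy f" and g: "cauchy g"
  shows "hvec f = hvec g \<longleftrightarrow> (\<lambda>n. nm (\<lambda>x. f n x - g n x)) \<longlonglongrightarrow> 0"
proof
  assume "hvec f = hvec g"
  then have "lift g \<in> hvec f" using lift_mem_vec[OF g] by simp
  then have "(lift f, lift g) \<in> cauchy_rel V" by (simp add: hvec_def)
  then show "(\<lambda>n. nm (\<lambda>x. f n x - g n x)) \<longlonglongrightarrow> 0" using cauchy_rel_lift assms by blast
next
  assume z: "(\<lambda>n. nm (\<lambda>x. f n x - g n x)) \<longlonglongrightarrow> 0"
  then have z': "(\<lambda>n. nm (\<lambda>x. g n x - f n x)) \<longlonglongrightarrow> 0"
    using nm_minus_commute[OF cauchy_mem[OF f] cauchy_mem[OF g]] by simp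
  show "hvec f = hvec g"
  proof (intro set_eqI iffI)
    fix w
    show "w \<in> hvec g" if "w \<in> hvec f"
      using that null_diff_trans[OF g f _ z'] unfolding mem_vec[OF f] mem_vec[OF g] by blast
    show "w \<in> hvec f" if "w \<in> hvec g"
      using that null_diff_trans[OF f g _ z] unfolding mem_vec[OF f] mem_vec[OF g] by blast
  qed
qed

lemma vadd_H:
  assumes f: "cauchy f" and g: "cauchy g"
  shows "vadd H (hvec f) (hvec g) = hvec (\<lambda>n x. f n x + g n x)"
proof -
  have "cauchy_rel V `` {\<lambda>n. vadd V (u n) (w n)} = hvec (\<lambda>n x. f n x + g n x)"
    if "u \<in> hvec f" "w \<in> hvec g" for u w
  proof -
    obtain f' where f': "cauchy f'" "u = lift f'" "(\<lambda>n. nm (\<lambda>x. f n x - f' n x)) \<longlonglongrightarrow> 0"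
      using \<open>u \<in> hvec f\<close> mem_vec[OF f] by auto
    obtain g' where g': "cauchy g'" "w = lift g'" "(\<lambda>n. nm (\<lambda>x. g n x - g' n x)) \<longlonglongrightarrow> 0"
      using \<open>w \<in> hvec g\<close> mem_vec[OF g] by auto
    have "hvec (\<lambda>n x. f n x + g n x) = hvec (\<lambda>n x. f' n x + g' n x)"
    proof (subst vec_eq_iff[OF cauchy_add[OF f g] cauchy_add[OF f'(1) g'(1)]], rule Lim_null_comparison)
      have "norm (nm (\<lambda>x. (f n x + g n x) - (f' n x + g' n x)))
        \<le> nm (\<lambda>x. f n x - f' n x) + nm (\<lambda>x. g n x - g' n x)" for n
      proof -
        have "(\<lambda>x. (f n x + g n x) - (f' n x + g' n x)) = (\<lambda>x. (f n x - f' n x) + (g n x - g' n x))"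
          by auto
        then show ?thesis
          using nm_triangle[of "\<lambda>x. f n x - f' n x" "\<lambda>x. g n x - g' n x"]
            nm_ge0[of "\<lambda>x. (f n x + g n x) - (f' n x + g' n x)"] f f' g g'
          by (simp add: mem cauchy_mem)
      qed
      then show "\<forall>\<^sub>F n in sequentially. norm (nm (\<lambda>x. (f n x + g n x) - (f' n x + g' n x)))
        \<le> nm (\<lambda>x. f n x - f' n x) + nm (\<lambda>x. g n x - g' n x)" by simp
      show "(\<lambda>n. nm (\<lambda>x. f n x - f' n x) + nm (\<lambda>x. g n x - g' n x)) \<longlonglongrightarrow> 0"
        using tendsto_add[OF f'(3) g'(3)] by simp
    qed
    then show ?thesis using f' g' by (simp add: hvec_def vadd_V cauchy_mem)
  qed
  then show ?thesis
    unfolding gns_space_def completion_def using lift_mem_vec[OF f] lift_mem_vec[OF g] by auto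
qed

lemma vscale_H:
  assumes f: "cauchy f"
  shows "vscale H c (hvec f) = hvec (\<lambda>n x. c * f n x)"
proof -
  have "cauchy_rel V `` {\<lambda>n. vscale V c (u n)} = hvec (\<lambda>n x. c * f n x)"
    if "u \<in> hvec f" for u
  proof -
    obtain f' where f': "cauchy f'" "u = lift f'" "(\<lambda>n. nm (\<lambda>x. f n x - f' n x)) \<longlonglongrightarrow> 0"
      using \<open>u \<in> hvec f\<close> mem_vec[OF f] by auto
    have "nm (\<lambda>x. c * f n x - c * f' n x) = cmod c * nm (\<lambda>x. f n x - f' n x)" for n
      using nm_scale[of "\<lambda>x. f n x - f' n x" c] by (simp add: mem cauchy_mem f f' right_diff_distrib)
    then have "(\<lambda>n. nm (\<lambda>x. c * f n x - c * f' n x)) \<longlonglongrightarrow> 0"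
      using tendsto_mult_right_zero[OF f'(3)] by simp
    then have "hvec (\<lambda>n x. c * f n x) = hvec (\<lambda>n x. c * f' n x)"
      using vec_eq_iff cauchy_scale f f'(1) by blast
    then show ?thesis using f' by (simp add: hvec_def vscale_V cauchy_mem)
  qed
  then show ?thesis
    unfolding gns_space_def completion_def using lift_mem_vec[OF f] by auto
qed

lemma vinner_H:
  assumes f: "cauchy f" and g: "cauchy g"
  shows "vinner H (hvec f) (hvec g) = lim (\<lambda>n. ip (f n) (g n))"
proof -
  have key: "lim (\<lambda>n. vinner V (u n) (w n)) = lim (\<lambda>n. ip (f n) (g n))"
    if "u \<in> hvec f" "w \<in> hvec g" for u w
  proof -
    obtain f' where f': "cauchy f'" "u = lift f'" "(\<lambda>n. nm (\<lambda>x. f n x - f' n x)) \<longlonglongrightarrow> 0"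
      using \<open>u \<in> hvec f\<close> mem_vec[OF f] by auto
    obtain g' where g': "cauchy g'" "w = lift g'" "(\<lambda>n. nm (\<lambda>x. g n x - g' n x)) \<longlonglongrightarrow> 0"
      using \<open>w \<in> hvec g\<close> mem_vec[OF g] by auto
    have z1: "(\<lambda>n. ip (\<lambda>x. f n x - f' n x) (g n)) \<longlonglongrightarrow> 0"
      by (intro inner_tendsto_zero mem cauchy_mem f f' g)
    have "(\<lambda>n. ip (\<lambda>x. g n x - g' n x) (f' n)) \<longlonglongrightarrow> 0"
      by (intro inner_tendsto_zero mem cauchy_mem f' g' g)
    then have "(\<lambda>n. cnj (ip (\<lambda>x. g n x - g' n x) (f' n))) \<longlonglongrightarrow> cnj 0" by (rule tendsto_cnj)
    moreover have "cnj (ip (\<lambda>x. g n x - g' n x) (f' n)) = ip (f' n) (\<lambda>x. g n x - g' n x)" for n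
      by (rule inner_cnj[symmetric]) (intro mem cauchy_mem f' g' g)+
    ultimately have z2: "(\<lambda>n. ip (f' n) (\<lambda>x. g n x - g' n x)) \<longlonglongrightarrow> 0" by simp
    have "(\<lambda>n. ip (f n) (g n) - ip (\<lambda>x. f n x - f' n x) (g n) - ip (f' n) (\<lambda>x. g n x - g' n x))
       \<longlonglongrightarrow> lim (\<lambda>n. ip (f n) (g n)) - 0 - 0"
      by (intro tendsto_diff z1 z2 cauchy_inner_lim f g)
    then have "(\<lambda>n. ip (f' n) (g' n)) \<longlonglongrightarrow> lim (\<lambda>n. ip (f n) (g n))"
      by (simp add: inner_diff_left inner_diff_right cauchy_mem f f'(1) g g'(1))
    then have "lim (\<lambda>n. ip (f' n) (g' n)) = lim (\<lambda>n. ip (f n) (g n))" by (rule limI)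
    then show ?thesis by (simp add: f'(2) g'(2) vinner_V cauchy_mem[OF f'(1)] cauchy_mem[OF g'(1)])
  qed
  have "(\<Union>u\<in>hvec f. \<Union>w\<in>hvec g. {lim (\<lambda>n. vinner V (u n) (w n))}) = {lim (\<lambda>n. ip (f n) (g n))}"
    using lift_mem_vec[OF f] lift_mem_vec[OF g] by (intro SUP_eq_const) (auto simp only: key)
  then show ?thesis by (simp add: gns_space_def completion_def)
qed

lemma vnorm_vdiff_H:
  assumes f: "cauchy f" and g: "cauchy g"
  shows "(\<lambda>n. nm (\<lambda>x. f n x - g n x)) \<longlonglongrightarrow> vnorm H (vdiff H (hvec f) (hvec g))"
proof -
  have d: "vdiff H (hvec f) (hvec g) = hvec (\<lambda>n x. f n x - g n x)"
    by (simp add: vdiff_def vscale_H vadd_H f g cauchy_scale[of g "-1", simplified])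
  have "(\<lambda>n. sqrt (Re (ip (\<lambda>x. f n x - g n x) (\<lambda>x. f n x - g n x))))
     \<longlonglongrightarrow> sqrt (Re (lim (\<lambda>n. ip (\<lambda>x. f n x - g n x) (\<lambda>x. f n x - g n x))))"
    by (intro tendsto_real_sqrt tendsto_Re cauchy_inner_lim cauchy_diff f g)
  then show ?thesis
    unfolding norm_\<Phi>_def vnorm_def d vinner_H[OF cauchy_diff[OF f g] cauchy_diff[OF f g]] .
qed

lemma embed_vec: "completion_embed V (cls b) = hvec (\<lambda>n. b)"
  by (simp add: completion_embed_def hvec_def)

text \<open>A sequence of embedded functions converges in the completion iff it is Cauchy in \<open>B\<close>, and its
  limit is then the vector which the sequence itself denotes. This is how limits in the completion,
  and with them closures of operators, are translated back to \<open>B\<close>.\<close>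

lemma vtendsto_vec:
  assumes b: "\<And>n. b n \<in> B" and f: "cauchy f"
  shows "vtendsto H (\<lambda>n. hvec (\<lambda>k. b n)) (hvec f) \<longleftrightarrow> cauchy b \<and> hvec f = hvec b"
proof
  assume t: "vtendsto H (\<lambda>n. hvec (\<lambda>k. b n)) (hvec f)"
  define d where "d n = vnorm H (vdiff H (hvec (\<lambda>k. b n)) (hvec f))" for n
  have d0: "d \<longlonglongrightarrow> 0" using t by (simp add: vtendsto_def d_def[abs_def])
  have dlim: "(\<lambda>k. nm (\<lambda>x. b n x - f k x)) \<longlonglongrightarrow> d n" for n
    unfolding d_def by (rule vnorm_vdiff_H[OF cauchy_const[OF b] f])
  \<comment> \<open>Pass to the limit \<open>k \<longlonglongrightarrow> \<infinity>\<close> in the triangle inequality through \<open>f k\<close>.\<close>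
  have "nm (\<lambda>x. b m x - b n x) \<le> d m + d n" for m n
  proof (rule LIMSEQ_le_const[OF tendsto_add[OF dlim[of m] dlim[of n]]], intro exI allI impI)
    fix k show "nm (\<lambda>x. b m x - b n x) \<le> nm (\<lambda>x. b m x - f k x) + nm (\<lambda>x. b n x - f k x)"
      using nm_diff_triangle[of "b m" "f k" "b n"] nm_minus_commute[of "f k" "b n"] b cauchy_mem[OF f]
      by simp
  qed
  then have cb: "cauchy b"
    using cauchyI_le[OF f b _ d0, of 0] by simp
  have "(\<lambda>n. nm (\<lambda>x. f n x - b n x)) \<longlonglongrightarrow> 0"
  proof (rule LIMSEQ_I)
    fix r :: real assume "0 < r"
    then have r: "0 < r / 3" by simp
    obtain N1 where N1: "\<And>n. n \<ge> N1 \<Longrightarrow> \<bar>d n\<bar> < r / 3" using LIMSEQ_D[OF d0 r] by auto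
    obtain N2 where N2: "\<And>m n. m \<ge> N2 \<Longrightarrow> n \<ge> N2 \<Longrightarrow> nm (\<lambda>x. f m x - f n x) < r / 3"
      using f r unfolding cauchy_def by meson
    show "\<exists>no. \<forall>n\<ge>no. norm (nm (\<lambda>x. f n x - b n x) - 0) < r"
    proof (intro exI allI impI)
      fix n assume n: "max N1 N2 \<le> n"
      have "nm (\<lambda>x. f n x - b n x) \<le> r / 3 + d n"
      proof (rule LIMSEQ_le_const[OF tendsto_add[OF tendsto_const dlim[of n]]], intro exI allI impI)
        fix k assume "N2 \<le> k"
        then show "nm (\<lambda>x. f n x - b n x) \<le> r / 3 + nm (\<lambda>x. b n x - f k x)"
          using nm_diff_triangle[of "f n" "f k" "b n"] nm_minus_commute[of "f k" "b n"] N2[of n k] n b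
            cauchy_mem[OF f] by simp
      qed
      then show "norm (nm (\<lambda>x. f n x - b n x) - 0) < r"
        using N1[of n] n nm_ge0[OF diff_mem[OF cauchy_mem[OF f] b], of n n] by simp
    qed
  qed
  with cb show "cauchy b \<and> hvec f = hvec b" by (simp add: vec_eq_iff f)
next
  assume cb: "cauchy b \<and> hvec f = hvec b"
  have "vtendsto H (\<lambda>n. hvec (\<lambda>k. b n)) (hvec b)"
    unfolding vtendsto_def
  proof (rule LIMSEQ_I)
    fix r :: real assume "0 < r"
    then have r: "0 < r / 2" by simp
    obtain N where N: "\<And>m n. m \<ge> N \<Longrightarrow> n \<ge> N \<Longrightarrow> nm (\<lambda>x. b m x - b n x) < r / 2"
      using cb r unfolding cauchy_def by meson
    have "\<bar>vnorm H (vdiff H (hvec (\<lambda>k. b n)) (hvec b))\<bar> < r" if n: "N \<le> n" for n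
    proof -
      have l: "(\<lambda>k. nm (\<lambda>x. b n x - b k x)) \<longlonglongrightarrow> vnorm H (vdiff H (hvec (\<lambda>k. b n)) (hvec b))"
        using cb by (intro vnorm_vdiff_H[OF cauchy_const[OF b]]) simp
      have "vnorm H (vdiff H (hvec (\<lambda>k. b n)) (hvec b)) \<le> r / 2"
        by (rule LIMSEQ_le_const2[OF l]) (use N n in \<open>auto intro!: exI[of _ N] less_imp_le\<close>)
      moreover have "0 \<le> vnorm H (vdiff H (hvec (\<lambda>k. b n)) (hvec b))"
        by (rule LIMSEQ_le_const[OF l]) (use nm_ge0 mem b in auto)
      ultimately show ?thesis using r by simp
    qed
    then show "\<exists>no. \<forall>n\<ge>no. norm (vnorm H (vdiff H (hvec (\<lambda>k. b n)) (hvec b)) - 0) < r" by auto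
  qed
  with cb show "vtendsto H (\<lambda>n. hvec (\<lambda>k. b n)) (hvec f)" by simp
qed

end

section \<open>Essential self-adjointness and dense ranges\<close>

context semi_inner
begin

lemma nm_parallelogram:
  assumes "f \<in> B" "g \<in> B"
  shows "(nm (\<lambda>x. f x - g x))\<^sup>2 = 2 * (nm f)\<^sup>2 + 2 * (nm g)\<^sup>2 - (nm (\<lambda>x. f x + g x))\<^sup>2"
  using nm_sq_diff_scale[OF assms, of 1] nm_sq_diff_scale[OF assms, of "-1"] by simp

text \<open>The orthogonal projection of \<open>p\<close> to the closure of \<open>W\<close>, expressed in \<open>B\<close>, where it need not
  exist as an element: a sequence \<open>r\<close> in \<open>W\<close> minimizing the distance to \<open>p\<close> is Cauchy by the
  parallelogram law, and \<open>p - r n\<close> is asymptotically orthogonal to \<open>W\<close> because moving \<open>r n\<close> in a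
  direction \<open>w\<close> of \<open>W\<close> cannot decrease the distance below its infimum.\<close>

lemma approximate_projection:
  assumes W: "fun_subspace W" "W \<subseteq> B" and p: "p \<in> B"
  obtains r where "\<And>n. r n \<in> W" "cauchy r" "\<And>w. w \<in> W \<Longrightarrow> (\<lambda>n. ip (\<lambda>x. p x - r n x) w) \<longlonglongrightarrow> 0"
proof -
  have W_mem: "(\<lambda>x. 0) \<in> W" "\<And>f g. f \<in> W \<Longrightarrow> g \<in> W \<Longrightarrow> (\<lambda>x. f x + g x) \<in> W"
    "\<And>c f. f \<in> W \<Longrightarrow> (\<lambda>x. c * f x) \<in> W"
    using W(1) unfolding fun_subspace_def by auto
  have WB: "w \<in> B" if "w \<in> W" for w using that W(2) by blast
  define dst where "dst w = nm (\<lambda>x. p x - w x)" for w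
  have dst0: "0 \<le> dst w" if "w \<in> W" for w
    unfolding dst_def by (rule nm_ge0) (simp add: mem p WB that)
  define d where "d = (INF w\<in>W. dst w)"
  have bdd: "bdd_below (dst ` W)" using dst0 by (auto intro: bdd_belowI[of _ 0])
  have d_le: "d \<le> dst w" if "w \<in> W" for w
    unfolding d_def using bdd that by (rule cINF_lower)
  have d0: "0 \<le> d"
    unfolding d_def using W_mem(1) dst0 by (intro cINF_greatest) auto
  define e where "e n = 1 / real (Suc n)" for n
  have e0: "0 < e n" for n by (simp add: e_def)
  have elim: "e \<longlonglongrightarrow> 0" unfolding e_def[abs_def] by (rule LIMSEQ_Suc[OF lim_1_over_n])
  have "\<exists>w\<in>W. dst w < d + e n" for n
    using cINF_less_iff[OF _ bdd, of "d + e n"] W_mem(1) e0[of n] unfolding d_def by auto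
  then obtain r where rW: "\<And>n. r n \<in> W" and r: "\<And>n. dst (r n) < d + e n" by metis
  have rB: "r n \<in> B" for n using rW WB by blast
  define f where "f n = (\<lambda>x. p x - r n x)" for n
  have fB: "f n \<in> B" for n unfolding f_def by (simp add: mem p rB)
  \<comment> \<open>The excess of the squared distance over the infimum.\<close>
  define q where "q n = (d + e n)\<^sup>2 - d\<^sup>2" for n
  have fsq: "(nm (f n))\<^sup>2 \<le> d\<^sup>2 + q n" for n
    using power_mono[OF less_imp_le[OF r[of n]] dst0[OF rW[of n]], of 2]
    by (simp add: q_def dst_def f_def)
  have q0: "0 \<le> q n" for n
    using d0 e0[of n] power_mono[of d "d + e n" 2] by (simp add: q_def)
  have qlim: "q \<longlonglongrightarrow> 0"
  proof -
    have "(\<lambda>n. (d + e n)\<^sup>2 - d\<^sup>2) \<longlonglongrightarrow> (d + 0)\<^sup>2 - d\<^sup>2"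
      by (intro tendsto_intros elim)
    then show ?thesis by (simp add: q_def[abs_def])
  qed
  have near: "(nm (\<lambda>x. r m x - r n x))\<^sup>2 \<le> 2 * q m + 2 * q n" for m n
  proof -
    have "(nm (\<lambda>x. f m x - f n x))\<^sup>2 = 2 * (nm (f m))\<^sup>2 + 2 * (nm (f n))\<^sup>2 - (nm (\<lambda>x. f m x + f n x))\<^sup>2"
      by (rule nm_parallelogram[OF fB fB])
    moreover have "4 * d\<^sup>2 \<le> (nm (\<lambda>x. f m x + f n x))\<^sup>2"
    proof -
      let ?w = "\<lambda>x. (1/2) * (r m x + r n x)"
      have "?w \<in> W" by (intro W_mem rW)
      then have "d \<le> nm (\<lambda>x. p x - ?w x)" using d_le by (simp add: dst_def)
      moreover have "(\<lambda>x. f m x + f n x) = (\<lambda>x. 2 * (p x - ?w x))"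
        by (simp add: f_def fun_eq_iff algebra_simps)
      moreover have "nm (\<lambda>x. 2 * (p x - ?w x)) = 2 * nm (\<lambda>x. p x - ?w x)"
        using nm_scale[of "\<lambda>x. p x - ?w x" 2] WB[OF \<open>?w \<in> W\<close>] p by (simp only: mem norm_numeral)
      ultimately have "2 * d \<le> nm (\<lambda>x. f m x + f n x)" by simp
      from power_mono[OF this, of 2] d0 show ?thesis by (simp add: power_mult_distrib)
    qed
    moreover have "(\<lambda>x. f m x - f n x) = (\<lambda>x. r n x - r m x)" by (simp add: f_def fun_eq_iff)
    ultimately show ?thesis
      using fsq[of m] fsq[of n] nm_minus_commute[OF rB rB, of m n] by simp
  qed
  have "cauchy r"
    unfolding cauchy_def
  proof (intro conjI allI impI rB)
    fix \<epsilon> :: real assume \<epsilon>: "0 < \<epsilon>"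
    then have "0 < \<epsilon>\<^sup>2 / 4" by simp
    from LIMSEQ_D[OF qlim this] obtain N where N: "\<And>n. n \<ge> N \<Longrightarrow> \<bar>q n\<bar> < \<epsilon>\<^sup>2 / 4" by auto
    show "\<exists>N. \<forall>m\<ge>N. \<forall>n\<ge>N. nm (\<lambda>x. r m x - r n x) < \<epsilon>"
    proof (intro exI allI impI)
      fix m n assume "N \<le> m" "N \<le> n"
      then have "(nm (\<lambda>x. r m x - r n x))\<^sup>2 < \<epsilon>\<^sup>2"
        using near[of m n] N[of m] N[of n] by linarith
      then show "nm (\<lambda>x. r m x - r n x) < \<epsilon>" using power2_less_imp_less \<epsilon> by fastforce
    qed
  qed
  moreover have "(\<lambda>n. ip (\<lambda>x. p x - r n x) w) \<longlonglongrightarrow> 0" if w: "w \<in> W" for w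
  proof -
    \<comment> \<open>Step length for the variation of \<open>r n\<close> along \<open>w\<close>; the summand \<open>1\<close> covers \<open>nm w = 0\<close>.\<close>
    define t where "t = 1 / (1 + (nm w)\<^sup>2)"
    have pos: "0 < 1 + (nm w)\<^sup>2" by (simp add: add_pos_nonneg)
    have t0: "0 < t" using pos by (simp add: t_def)
    have tle: "t * (nm w)\<^sup>2 \<le> 1" using pos by (simp add: t_def)
    have bound: "(cmod (ip (f n) w))\<^sup>2 \<le> q n / t" for n
    proof -
      define c where "c = of_real t * cnj (ip (f n) w)"
      define u where "u = (cmod (ip (f n) w))\<^sup>2"
      have "(\<lambda>x. r n x + c * w x) \<in> W" by (intro W_mem rW w)
      then have "d \<le> nm (\<lambda>x. f n x - c * w x)"
        using d_le by (force simp: dst_def f_def algebra_simps)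
      then have "d\<^sup>2 \<le> (nm (\<lambda>x. f n x - c * w x))\<^sup>2" using d0 power_mono by blast
      also have "\<dots> = (nm (f n))\<^sup>2 - 2 * Re (c * ip (f n) w) + (cmod c)\<^sup>2 * (nm w)\<^sup>2"
        by (rule nm_sq_diff_scale[OF fB WB[OF w]])
      also have "c * ip (f n) w = of_real (t * u)"
        using complex_norm_square[of "ip (f n) w"] by (simp add: c_def u_def mult.commute)
      also have "(cmod c)\<^sup>2 = t\<^sup>2 * u"
        by (simp add: c_def u_def norm_mult power_mult_distrib)
      finally have "2 * (t * u) \<le> q n + t\<^sup>2 * u * (nm w)\<^sup>2"
        using fsq[of n] by simp
      also have "t\<^sup>2 * u * (nm w)\<^sup>2 = (t * u) * (t * (nm w)\<^sup>2)"
        by (simp add: power2_eq_square)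
      also have "\<dots> \<le> (t * u) * 1"
        using tle t0 by (intro mult_left_mono) (auto simp: u_def)
      finally show ?thesis using t0 by (simp add: u_def field_simps)
    qed
    have "(\<lambda>n. (cmod (ip (f n) w))\<^sup>2) \<longlonglongrightarrow> 0"
    proof (rule Lim_null_comparison)
      show "\<forall>\<^sub>F n in sequentially. norm ((cmod (ip (f n) w))\<^sup>2) \<le> q n / t" using bound by simp
      show "(\<lambda>n. q n / t) \<longlonglongrightarrow> 0" using tendsto_divide_zero[OF qlim] .
    qed
    then have "(\<lambda>n. sqrt ((cmod (ip (f n) w))\<^sup>2)) \<longlonglongrightarrow> sqrt 0" by (rule tendsto_real_sqrt)
    then show ?thesis by (simp add: f_def tendsto_norm_zero_iff)
  qed
  ultimately show thesis using that[of r] rW by blast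
qed

end

locale symmetric_operator = semi_inner +
  fixes a :: "'a \<Rightarrow> complex"
  assumes mult_mem: "f \<in> B \<Longrightarrow> (\<lambda>x. a x * f x) \<in> B"
    and mult_sym: "\<lbrakk>f \<in> B; g \<in> B\<rbrakk> \<Longrightarrow>
      inner_\<Phi> \<Phi> (\<lambda>x. a x * f x) g = inner_\<Phi> \<Phi> f (\<lambda>x. a x * g x)"
begin

abbreviation T where "T \<equiv> gns_operator \<Phi> B a"

text \<open>Density of the range of \<open>a + z\<close> inside \<open>B\<close> itself. For \<open>z = \<i>\<close> and \<open>z = - \<i>\<close> this says
  that a deficiency space of the operator is trivial.\<close>

definition dense_range :: "complex \<Rightarrow> bool" where
  "dense_range z \<longleftrightarrow> (\<forall>p\<in>B. \<forall>\<epsilon>>0. \<exists>c\<in>B. nm (\<lambda>x. p x - (a x * c x + z * c x)) < \<epsilon>)"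

text \<open>The cross term \<open>z \<cdot> ip (a c) c\<close> is imaginary by symmetry. Hence the graph norm of \<open>a\<close> is the
  norm after application of \<open>a + z\<close>.\<close>

lemma nm_shift:
  assumes c: "c \<in> B" and z: "z = \<i> \<or> z = - \<i>"
  shows "(nm (\<lambda>x. a x * c x + z * c x))\<^sup>2 = (nm (\<lambda>x. a x * c x))\<^sup>2 + (nm c)\<^sup>2"
proof -
  have "Im (ip (\<lambda>x. a x * c x) c) = 0"
    using inner_cnj[OF mult_mem[OF c] c] mult_sym[OF c c] by (auto simp: complex_eq_iff)
  then have "Re ((- z) * ip (\<lambda>x. a x * c x) c) = 0" using z by auto
  moreover have "cmod (- z) = 1" using z by auto
  ultimately show ?thesis
    using nm_sq_diff_scale[OF mult_mem[OF c] c, of "- z"] by simp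
qed

lemma gns_operator_hvec: "T = {(hvec (\<lambda>n. b), hvec (\<lambda>n x. a x * b x)) | b. b \<in> B}"
  by (simp add: gns_operator_def embed_vec)

lemma op_closure_iff:
  "(u, v) \<in> op_closure H T \<longleftrightarrow>
    (\<exists>b. cauchy b \<and> cauchy (\<lambda>n x. a x * b n x) \<and> u = hvec b \<and> v = hvec (\<lambda>n x. a x * b n x))"
proof
  assume cl: "(u, v) \<in> op_closure H T"
  then obtain s t where st: "\<And>n. (s n, t n) \<in> T" and s: "vtendsto H s u" and t: "vtendsto H t v"
    and uv: "u \<in> vecs H" "v \<in> vecs H"
    by (auto simp: op_closure_def)
  have "\<exists>b\<in>B. s n = hvec (\<lambda>k. b) \<and> t n = hvec (\<lambda>k x. a x * b x)" for n
    using st[of n] by (auto simp: gns_operator_hvec)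
  then obtain b where b: "\<And>n. b n \<in> B" and sb: "s = (\<lambda>n. hvec (\<lambda>k. b n))"
    and tb: "t = (\<lambda>n. hvec (\<lambda>k x. a x * b n x))"
    by metis
  obtain f g where f: "cauchy f" "u = hvec f" and g: "cauchy g" "v = hvec g"
    using uv by (auto simp: vecs_H)
  show "\<exists>b. cauchy b \<and> cauchy (\<lambda>n x. a x * b n x) \<and> u = hvec b \<and> v = hvec (\<lambda>n x. a x * b n x)"
  proof (intro exI conjI)
    have 1: "cauchy b \<and> hvec f = hvec b"
      using s unfolding sb f(2) vtendsto_vec[OF b f(1)] .
    have 2: "cauchy (\<lambda>n x. a x * b n x) \<and> hvec g = hvec (\<lambda>n x. a x * b n x)"
      using t unfolding tb g(2) vtendsto_vec[OF mult_mem[OF b] g(1)] .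
    show "cauchy b" "cauchy (\<lambda>n x. a x * b n x)" "u = hvec b" "v = hvec (\<lambda>n x. a x * b n x)"
      using 1 2 f(2) g(2) by simp_all
  qed
next
  assume "\<exists>b. cauchy b \<and> cauchy (\<lambda>n x. a x * b n x) \<and> u = hvec b \<and> v = hvec (\<lambda>n x. a x * b n x)"
  then obtain b where b: "cauchy b" "cauchy (\<lambda>n x. a x * b n x)"
    and uv: "u = hvec b" "v = hvec (\<lambda>n x. a x * b n x)"
    by blast
  have "vtendsto H (\<lambda>n. hvec (\<lambda>k. b n)) u" "vtendsto H (\<lambda>n. hvec (\<lambda>k x. a x * b n x)) v"
    unfolding uv using vtendsto_vec[OF cauchy_mem[OF b(1)] b(1)]
      vtendsto_vec[OF cauchy_mem[OF b(2)] b(2)] b by simp_all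
  moreover have "\<forall>n. (hvec (\<lambda>k. b n), hvec (\<lambda>k x. a x * b n x)) \<in> T"
    using cauchy_mem[OF b(1)] by (auto simp: gns_operator_hvec)
  moreover have "u \<in> vecs H" "v \<in> vecs H" using b uv by (auto simp: vecs_H)
  ultimately show "(u, v) \<in> op_closure H T"
    unfolding op_closure_def mem_Collect_eq prod.case by (intro conjI exI) assumption+
qed

text \<open>By definition the adjoint is a relation between limits of inner products; since these limits
  always exist, equality of the limits is nullity of the difference.\<close>

lemma op_adjoint_iff:
  assumes f: "cauchy f" and g: "cauchy g"
  shows "(hvec f, hvec g) \<in> op_adjoint H T \<longleftrightarrow>
    (\<forall>c\<in>B. (\<lambda>n. ip (f n) (\<lambda>x. a x * c x) - ip (g n) c) \<longlonglongrightarrow> 0)"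
proof -
  have "vinner H (hvec f) (hvec (\<lambda>n x. a x * c x)) = vinner H (hvec g) (hvec (\<lambda>n. c)) \<longleftrightarrow>
      (\<lambda>n. ip (f n) (\<lambda>x. a x * c x) - ip (g n) c) \<longlonglongrightarrow> 0" if c: "c \<in> B" for c
  proof -
    let ?l = "lim (\<lambda>n. ip (f n) (\<lambda>x. a x * c x))" and ?r = "lim (\<lambda>n. ip (g n) c)"
    have "(\<lambda>n. ip (f n) (\<lambda>x. a x * c x) - ip (g n) c) \<longlonglongrightarrow> ?l - ?r"
      by (intro tendsto_diff cauchy_inner_lim[OF f cauchy_const[OF mult_mem[OF c]]]
          cauchy_inner_lim[OF g cauchy_const[OF c]])
    then have "(\<lambda>n. ip (f n) (\<lambda>x. a x * c x) - ip (g n) c) \<longlonglongrightarrow> 0 \<longleftrightarrow> ?l - ?r = 0"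
      using LIMSEQ_unique[of _ "?l - ?r" 0] by auto
    then show ?thesis
      by (simp add: vinner_H[OF f cauchy_const[OF mult_mem[OF c]]] vinner_H[OF g cauchy_const[OF c]])
  qed
  moreover have "(hvec f, hvec g) \<in> op_adjoint H T \<longleftrightarrow>
    (\<forall>c\<in>B. vinner H (hvec f) (hvec (\<lambda>n x. a x * c x)) = vinner H (hvec g) (hvec (\<lambda>n. c)))"
  proof -
    have "hvec f \<in> vecs H" "hvec g \<in> vecs H" using f g by (simp_all add: vecs_H)
    then show ?thesis by (auto simp: op_adjoint_def gns_operator_hvec)
  qed
  ultimately show ?thesis by simp
qed

text \<open>Let \<open>f\<close> denote the component of \<open>p\<close> orthogonal to the range of \<open>a + z\<close>. It lies in the domain
  of the adjoint, with image \<open>z f\<close>, hence in the domain of the closure. There the operator is still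
  symmetric, so that it has no eigenvector for the non-real number \<open>z\<close>: by \<open>nm_shift\<close> the norm of
  \<open>f\<close> is bounded by that of \<open>a f - z f = 0\<close>. So \<open>f = 0\<close>, and \<open>p\<close> is in the closure of the range.\<close>

lemma essentially_selfadjoint_imp_dense_range:
  assumes sa: "essentially_selfadjoint H T" and z: "z = \<i> \<or> z = - \<i>"
  shows "dense_range z"
  unfolding dense_range_def
proof (intro ballI allI impI)
  fix p and \<epsilon> :: real assume p: "p \<in> B" and \<epsilon>: "0 < \<epsilon>"
  define sh where "sh c = (\<lambda>x. a x * c x + z * c x)" for c
  define W where "W = sh ` B"
  have shB: "sh c \<in> B" if "c \<in> B" for c using that by (simp add: sh_def mem mult_mem)
  have cz: "cnj z = - z" using z by auto
  have W: "fun_subspace W" "W \<subseteq> B"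
  proof -
    have "(\<lambda>x. 0) = sh (\<lambda>x. 0)" by (simp add: sh_def)
    moreover have "(\<lambda>x. sh f x + sh g x) = sh (\<lambda>x. f x + g x)" for f g
      by (simp add: sh_def algebra_simps fun_eq_iff)
    moreover have "(\<lambda>x. c * sh f x) = sh (\<lambda>x. c * f x)" for c f
      by (simp add: sh_def algebra_simps fun_eq_iff)
    ultimately show "fun_subspace W"
      unfolding fun_subspace_def W_def using mem by auto
  qed (use shB W_def in auto)
  obtain r where r: "\<And>n. r n \<in> W" "cauchy r"
    and orth: "\<And>w. w \<in> W \<Longrightarrow> (\<lambda>n. ip (\<lambda>x. p x - r n x) w) \<longlonglongrightarrow> 0"
    using approximate_projection[OF W p] by blast
  define f where "f n = (\<lambda>x. p x - r n x)" for n
  have f: "cauchy f"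
    using cauchy_diff[OF cauchy_const[OF p] r(2)] by (simp add: f_def[abs_def])
  have fB: "f n \<in> B" for n using cauchy_mem[OF f] .
  have orth': "(\<lambda>n. ip (f n) (sh c)) \<longlonglongrightarrow> 0" if "c \<in> B" for c
    using orth[of "sh c"] that by (simp add: f_def W_def)
  have "(hvec f, hvec (\<lambda>n x. z * f n x)) \<in> op_adjoint H T"
    unfolding op_adjoint_iff[OF f cauchy_scale[OF f]]
  proof
    fix c assume c: "c \<in> B"
    have "ip (f n) (\<lambda>x. a x * c x) - ip (\<lambda>x. z * f n x) c = ip (f n) (sh c)" for n
      by (simp add: sh_def inner_add_right inner_scale_left inner_scale_right fB c mem mult_mem cz)
    then show "(\<lambda>n. ip (f n) (\<lambda>x. a x * c x) - ip (\<lambda>x. z * f n x) c) \<longlonglongrightarrow> 0"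
      using orth'[OF c] by simp
  qed
  then have "hvec f \<in> Domain (op_closure H T)"
    using sa unfolding essentially_selfadjoint_def by blast
  then obtain b where b: "cauchy b" and ab: "cauchy (\<lambda>n x. a x * b n x)" and fb: "hvec f = hvec b"
    using op_closure_iff by blast
  have bB: "b n \<in> B" for n using cauchy_mem[OF b] .
  have fb0: "(\<lambda>n. nm (\<lambda>x. f n x - b n x)) \<longlonglongrightarrow> 0" using fb vec_eq_iff[OF f b] by simp
  \<comment> \<open>The eigenvector equation for \<open>f\<close>, tested on the sequence \<open>b\<close> in the domain of the operator.\<close>
  define w where "w n = (\<lambda>x. a x * b n x + (- z) * b n x)" for n
  have w: "cauchy w"
    unfolding w_def[abs_def] by (rule cauchy_add[OF ab cauchy_scale[OF b]])
  have "(\<lambda>n. ip (w n) c) \<longlonglongrightarrow> 0" if c: "c \<in> B" for c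
  proof -
    have "ip (w n) c = ip (f n) (sh c) - ip (\<lambda>x. f n x - b n x) (sh c)" for n
    proof -
      have "ip (w n) c = ip (b n) (sh c)"
        unfolding w_def sh_def
        by (simp add: inner_add_right inner_add_left inner_diff_left mult_sym inner_scale_left
            inner_scale_right bB c mem mult_mem cz)
      then show ?thesis by (simp add: inner_diff_left fB bB shB c)
    qed
    moreover have "(\<lambda>n. ip (\<lambda>x. f n x - b n x) (sh c)) \<longlonglongrightarrow> 0"
      by (rule inner_tendsto_zero[OF _ fb0 cauchy_const[OF shB[OF c]]]) (simp add: mem fB bB)
    ultimately show ?thesis using tendsto_diff[OF orth'[OF c]] by fastforce
  qed
  then have "(\<lambda>n. nm (w n)) \<longlonglongrightarrow> 0" by (rule weakly_null_cauchy[OF w])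
  moreover have "nm (b n) \<le> nm (w n)" for n
  proof -
    have "- z = \<i> \<or> - z = - \<i>" using z by auto
    from nm_shift[OF bB this, of n] have "(nm (b n))\<^sup>2 \<le> (nm (w n))\<^sup>2" unfolding w_def by simp
    then show ?thesis using nm_ge0[OF cauchy_mem[OF w]] power2_le_imp_le by blast
  qed
  ultimately have "(\<lambda>n. nm (b n)) \<longlonglongrightarrow> 0"
    using nm_ge0[OF bB] by (intro Lim_null_comparison[of "\<lambda>n. nm (b n)"]) auto
  from tendsto_add[OF fb0 this] have "(\<lambda>n. nm (\<lambda>x. f n x - b n x) + nm (b n)) \<longlonglongrightarrow> 0" by simp
  from LIMSEQ_D[OF this \<epsilon>] obtain n where "norm (nm (\<lambda>x. f n x - b n x) + nm (b n) - 0) < \<epsilon>"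
    by blast
  then have "nm (\<lambda>x. f n x - b n x) + nm (b n) < \<epsilon>" by simp
  then have "nm (f n) < \<epsilon>" using nm_le_diff[OF fB bB, of n n] by simp
  moreover obtain c where "c \<in> B" "r n = sh c" using r(1)[of n] by (auto simp: W_def)
  ultimately show "\<exists>c\<in>B. nm (\<lambda>x. p x - (a x * c x + z * c x)) < \<epsilon>"
    unfolding f_def sh_def by auto
qed

text \<open>The domain of the closure is in that of the adjoint by symmetry. Conversely let \<open>u\<close> (denoted by
  \<open>f\<close>) be in the domain of the adjoint, with image \<open>g\<close>. As the range of \<open>a + \<i>\<close> is dense and
  \<open>a + \<i>\<close> is bounded below, there is \<open>b\<close> in the domain of the closure with
  \<open>(a + \<i>) b = g + \<i> f\<close>. Then \<open>f - b\<close> is annihilated by the adjoint plus \<open>\<i>\<close>, that is, orthogonal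
  to the range of \<open>a - \<i>\<close>; this range is dense, and so \<open>f = b\<close>.\<close>

lemma dense_range_imp_essentially_selfadjoint:
  assumes dp: "dense_range \<i>" and dm: "dense_range (- \<i>)"
  shows "essentially_selfadjoint H T"
  unfolding essentially_selfadjoint_def
proof
  show "Domain (op_closure H T) \<subseteq> Domain (op_adjoint H T)"
  proof
    fix u assume "u \<in> Domain (op_closure H T)"
    then obtain b where b: "cauchy b" and ab: "cauchy (\<lambda>n x. a x * b n x)" and u: "u = hvec b"
      using op_closure_iff by blast
    have "(hvec b, hvec (\<lambda>n x. a x * b n x)) \<in> op_adjoint H T"
      unfolding op_adjoint_iff[OF b ab] by (simp add: mult_sym cauchy_mem[OF b])
    then show "u \<in> Domain (op_adjoint H T)" using u by blast
  qed
  show "Domain (op_adjoint H T) \<subseteq> Domain (op_closure H T)"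
  proof
    fix u assume "u \<in> Domain (op_adjoint H T)"
    then obtain v where uv: "(u, v) \<in> op_adjoint H T" by blast
    then obtain f g where f: "cauchy f" and g: "cauchy g" and u: "u = hvec f" and v: "v = hvec g"
      by (auto simp: op_adjoint_def vecs_H)
    have fB: "f n \<in> B" and gB: "g n \<in> B" for n using cauchy_mem f g by auto
    have adj: "\<And>c. c \<in> B \<Longrightarrow> (\<lambda>n. ip (f n) (\<lambda>x. a x * c x) - ip (g n) c) \<longlonglongrightarrow> 0"
      using uv op_adjoint_iff[OF f g] unfolding u v by blast
    define h where "h n = (\<lambda>x. g n x + \<i> * f n x)" for n
    have h: "cauchy h" unfolding h_def[abs_def] by (rule cauchy_add[OF g cauchy_scale[OF f]])
    have hB: "h n \<in> B" for n using cauchy_mem[OF h] .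
    have "\<exists>c\<in>B. nm (\<lambda>x. h n x - (a x * c x + \<i> * c x)) < 1 / real (Suc n)" for n
      using dp hB[of n] unfolding dense_range_def by (meson of_nat_0_less_iff zero_less_Suc zero_less_divide_1_iff)
    then obtain b where bB: "\<And>n. b n \<in> B"
      and b: "\<And>n. nm (\<lambda>x. h n x - (a x * b n x + \<i> * b n x)) < 1 / real (Suc n)" by metis
    define s where "s n = (\<lambda>x. a x * b n x + \<i> * b n x)" for n
    have sB: "s n \<in> B" for n unfolding s_def by (simp add: mem mult_mem bB)
    have hs: "nm (\<lambda>x. h n x - s n x) < 1 / real (Suc n)" for n using b by (simp add: s_def)
    have elim: "(\<lambda>n. 1 / real (Suc n)) \<longlonglongrightarrow> 0" by (rule LIMSEQ_Suc[OF lim_1_over_n])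
    have s_near: "nm (\<lambda>x. s m x - s n x) \<le> nm (\<lambda>x. h m x - h n x) + 1 / real (Suc m) + 1 / real (Suc n)"
      for m n
      using nm_diff_triangle[OF sB hB sB, of m n m] nm_diff_triangle[OF hB hB sB, of m n n]
        nm_minus_commute[OF sB hB, of m m] hs[of m] hs[of n] by linarith
    have shift: "(nm (\<lambda>x. s m x - s n x))\<^sup>2 =
        (nm (\<lambda>x. a x * b m x - a x * b n x))\<^sup>2 + (nm (\<lambda>x. b m x - b n x))\<^sup>2" for m n
    proof -
      have "(\<lambda>x. s m x - s n x) = (\<lambda>x. a x * (b m x - b n x) + \<i> * (b m x - b n x))"
        by (simp add: s_def algebra_simps fun_eq_iff)
      then show ?thesis using nm_shift[of "\<lambda>x. b m x - b n x" \<i>] bB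
        by (simp add: mem right_diff_distrib)
    qed
    have le1: "nm (\<lambda>x. b m x - b n x) \<le> nm (\<lambda>x. s m x - s n x)"
      and le2: "nm (\<lambda>x. a x * b m x - a x * b n x) \<le> nm (\<lambda>x. s m x - s n x)" for m n
      by (rule power2_le_imp_le[OF _ nm_ge0[OF diff_mem[OF sB sB]]], simp add: shift)+
    have cb: "cauchy b"
    proof (rule cauchyI_le[OF h bB _ elim, of 1])
      show "nm (\<lambda>x. b m x - b n x) \<le> 1 * nm (\<lambda>x. h m x - h n x) + 1 / real (Suc m) + 1 / real (Suc n)"
        for m n using le1[of m n] s_near[of m n] by linarith
    qed simp
    have cab: "cauchy (\<lambda>n x. a x * b n x)"
    proof (rule cauchyI_le[OF h mult_mem[OF bB] _ elim, of 1])
      show "nm (\<lambda>x. a x * b m x - a x * b n x)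
          \<le> 1 * nm (\<lambda>x. h m x - h n x) + 1 / real (Suc m) + 1 / real (Suc n)"
        for m n using le2[of m n] s_near[of m n] by linarith
    qed simp
    define w where "w n = (\<lambda>x. f n x - b n x)" for n
    have w: "cauchy w" unfolding w_def[abs_def] by (rule cauchy_diff[OF f cb])
    have wB: "w n \<in> B" for n using cauchy_mem[OF w] .
    have hs0: "(\<lambda>n. nm (\<lambda>x. h n x - s n x)) \<longlonglongrightarrow> 0"
    proof (rule Lim_null_comparison[OF _ elim])
      show "\<forall>\<^sub>F n in sequentially. norm (nm (\<lambda>x. h n x - s n x)) \<le> 1 / real (Suc n)"
        using hs nm_ge0[OF diff_mem[OF hB sB]] by (simp add: less_imp_le)
    qed
    have orth: "(\<lambda>n. ip (w n) (\<lambda>x. a x * c x + (- \<i>) * c x)) \<longlonglongrightarrow> 0" if c: "c \<in> B" for c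
    proof -
      have "ip (w n) (\<lambda>x. a x * c x + (- \<i>) * c x) =
          (ip (f n) (\<lambda>x. a x * c x) - ip (g n) c) + ip (\<lambda>x. h n x - s n x) c" for n
      proof -
        have "ip (w n) (\<lambda>x. a x * c x + (- \<i>) * c x) =
            ip (f n) (\<lambda>x. a x * c x) - \<i> * ip (f n) c - ip (b n) (\<lambda>x. a x * c x) + \<i> * ip (b n) c"
          unfolding w_def inner_add_right[OF wB[unfolded w_def] mult_mem[OF c] scale_mem[OF c]]
          by (simp only: inner_diff_left inner_scale_right fB bB c mem mult_mem) (simp add: algebra_simps)
        moreover have "ip (\<lambda>x. h n x - s n x) c =
            ip (g n) c - \<i> * ip (f n) c - ip (b n) (\<lambda>x. a x * c x) + \<i> * ip (b n) c"
          by (simp add: h_def s_def inner_diff_left inner_add_left inner_scale_left mult_sym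
              fB gB bB c mem mult_mem)
        ultimately show ?thesis by simp
      qed
      moreover have "(\<lambda>n. ip (\<lambda>x. h n x - s n x) c) \<longlonglongrightarrow> 0"
        by (rule inner_tendsto_zero[OF _ hs0 cauchy_const[OF c]]) (simp add: mem hB sB)
      ultimately show ?thesis using tendsto_add[OF adj[OF c]] by fastforce
    qed
    \<comment> \<open>Orthogonality extends from the dense range of \<open>a - \<i>\<close> to all of \<open>B\<close>, as \<open>w\<close> is bounded.\<close>
    have "(\<lambda>n. ip (w n) p) \<longlonglongrightarrow> 0" if p: "p \<in> B" for p
    proof (rule LIMSEQ_I)
      fix r :: real assume r: "0 < r"
      obtain K where K: "0 < K" "\<And>n. nm (w n) \<le> K" using cauchy_bounded[OF w] by blast
      obtain c where c: "c \<in> B" and pc: "nm (\<lambda>x. p x - (a x * c x + (- \<i>) * c x)) < r / (2 * K)"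
        using dm p r K unfolding dense_range_def by (meson divide_pos_pos mult_pos_pos zero_less_numeral)
      let ?q = "\<lambda>x. a x * c x + (- \<i>) * c x"
      have qB: "?q \<in> B" by (intro add_mem scale_mem mult_mem c)
      obtain N where N: "\<And>n. n \<ge> N \<Longrightarrow> norm (ip (w n) ?q) < r / 2"
        using LIMSEQ_D[OF orth[OF c], of "r / 2"] r by auto
      show "\<exists>no. \<forall>n\<ge>no. norm (ip (w n) p - 0) < r"
      proof (intro exI allI impI)
        fix n assume n: "N \<le> n"
        have "ip (w n) p = ip (w n) ?q + ip (w n) (\<lambda>x. p x - ?q x)"
          by (simp only: inner_diff_right[OF wB p qB]) simp
        then have "norm (ip (w n) p) \<le> norm (ip (w n) ?q) + norm (ip (w n) (\<lambda>x. p x - ?q x))"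
          by (metis norm_triangle_ineq)
        also have "norm (ip (w n) (\<lambda>x. p x - ?q x)) \<le> nm (w n) * nm (\<lambda>x. p x - ?q x)"
          by (rule cauchy_schwarz[OF wB diff_mem[OF p qB]])
        also have "\<dots> \<le> K * nm (\<lambda>x. p x - ?q x)"
          by (rule mult_right_mono[OF K(2) nm_ge0[OF diff_mem[OF p qB]]])
        also have "\<dots> \<le> K * (r / (2 * K))"
          using pc K by (intro mult_left_mono) auto
        also have "\<dots> = r / 2" using K by simp
        finally show "norm (ip (w n) p - 0) < r" using N[OF n] by simp
      qed
    qed
    then have "(\<lambda>n. nm (w n)) \<longlonglongrightarrow> 0" by (rule weakly_null_cauchy[OF w])
    then have "hvec f = hvec b" by (simp add: vec_eq_iff[OF f cb] w_def)
    then have "(u, hvec (\<lambda>n x. a x * b n x)) \<in> op_closure H T"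
      using op_closure_iff cb cab u by blast
    then show "u \<in> Domain (op_closure H T)" by blast
  qed
qed

theorem essentially_selfadjoint_iff_dense_range:
  "essentially_selfadjoint H T \<longleftrightarrow> dense_range \<i> \<and> dense_range (- \<i>)"
  using essentially_selfadjoint_imp_dense_range dense_range_imp_essentially_selfadjoint by blast

end

section \<open>The seminorm of a Daniell functional\<close>

lemma complexification_iff:
  "f \<in> complexification A \<longleftrightarrow> (\<lambda>x. Re (f x)) \<in> A \<and> (\<lambda>x. Im (f x)) \<in> A"
proof
  assume "(\<lambda>x. Re (f x)) \<in> A \<and> (\<lambda>x. Im (f x)) \<in> A"
  moreover have "f = (\<lambda>x. of_real_fun (\<lambda>x. Re (f x)) x + \<i> * of_real_fun (\<lambda>x. Im (f x)) x)"
    by (simp add: of_real_fun_def fun_eq_iff complex_eq_iff)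
  ultimately show "f \<in> complexification A" unfolding complexification_def by blast
qed (auto simp: complexification_def of_real_fun_def)

lemma of_real_fun_mem_complexification:
  "fun_subspace A \<Longrightarrow> f \<in> A \<Longrightarrow> of_real_fun f \<in> complexification A"
  by (simp add: complexification_iff of_real_fun_def fun_subspace_def)

lemma fun_subspace_complexification:
  assumes A: "fun_subspace (A :: ('a \<Rightarrow> real) set)"
  shows "fun_subspace (complexification A)"
proof -
  have add: "(\<lambda>x. f x + g x) \<in> A" if "f \<in> A" "g \<in> A" for f g
    using A that by (simp add: fun_subspace_def)
  have lin: "(\<lambda>x. c * f x + d * g x) \<in> A" if "f \<in> A" "g \<in> A" for c d f g
    using A that by (simp add: fun_subspace_def)
  have "(\<lambda>x. c * f x - d * g x) \<in> A" if "f \<in> A" "g \<in> A" for c d f g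
    using lin[OF that, of c "- d"] by simp
  then show ?thesis
    using A add lin unfolding fun_subspace_def by (auto simp: complexification_iff)
qed

lemma complex_span_eq_complexification:
  assumes A: "fun_subspace (A :: ('a \<Rightarrow> real) set)"
  shows "complex_span A = complexification A"
  unfolding complex_span_def
proof (rule hull_unique)
  show "of_real_fun ` A \<subseteq> complexification A"
    using of_real_fun_mem_complexification[OF A] by blast
  show "fun_subspace (complexification A)" by (rule fun_subspace_complexification[OF A])
  fix W :: "('a \<Rightarrow> complex) set" assume W: "of_real_fun ` A \<subseteq> W" "fun_subspace W"
  show "complexification A \<subseteq> W"
  proof
    fix f assume "f \<in> complexification A"
    then obtain r i where f: "f = (\<lambda>x. of_real_fun r x + \<i> * of_real_fun i x)" "r \<in> A" "i \<in> A"
      by (auto simp: complexification_def)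
    then have "of_real_fun r \<in> W" "(\<lambda>x. \<i> * of_real_fun i x) \<in> W"
      using W unfolding fun_subspace_def by auto
    moreover have "\<And>g h. g \<in> W \<Longrightarrow> h \<in> W \<Longrightarrow> (\<lambda>x. g x + h x) \<in> W"
      using W(2) by (simp add: fun_subspace_def)
    ultimately show "f \<in> W" unfolding f(1) by simp
  qed
qed

locale daniell =
  fixes I :: "('a::t2_space \<Rightarrow> real) set" and \<Phi> :: "('a \<Rightarrow> real) \<Rightarrow> real"
  assumes ideal: "riesz_ideal I" and algebra: "unital_subalgebra I"
    and positive: "positive_linear_on I \<Phi>" and strict: "strictly_continuous_on I \<Phi>"
begin

lemma I_cont: "f \<in> I \<Longrightarrow> continuous_on UNIV f"
  using ideal by (auto simp: riesz_ideal_def continuous_functions_def)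

lemma I_dominated: "\<lbrakk>continuous_on UNIV f; g \<in> I; \<And>x. \<bar>f x\<bar> \<le> \<bar>g x\<bar>\<rbrakk> \<Longrightarrow> f \<in> I"
  using ideal by (auto simp: riesz_ideal_def continuous_functions_def)

lemma I_subspace: "fun_subspace I" using ideal by (simp add: riesz_ideal_def)

lemma I_zero: "(\<lambda>x. 0) \<in> I"
  and I_add: "\<lbrakk>f \<in> I; g \<in> I\<rbrakk> \<Longrightarrow> (\<lambda>x. f x + g x) \<in> I"
  and I_scale: "f \<in> I \<Longrightarrow> (\<lambda>x. c * f x) \<in> I"
  using I_subspace unfolding fun_subspace_def by auto

lemma I_mult: "\<lbrakk>f \<in> I; g \<in> I\<rbrakk> \<Longrightarrow> (\<lambda>x. f x * g x) \<in> I"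
  and I_one: "(\<lambda>x. 1) \<in> I"
  using algebra unfolding unital_subalgebra_def by auto

lemma I_const: "(\<lambda>x. c) \<in> I" using I_scale[OF I_one, of c] by simp

lemma I_minus: "f \<in> I \<Longrightarrow> (\<lambda>x. - f x) \<in> I" using I_scale[of f "-1"] by simp

lemma I_diff: "\<lbrakk>f \<in> I; g \<in> I\<rbrakk> \<Longrightarrow> (\<lambda>x. f x - g x) \<in> I"
  using I_add[OF _ I_minus, of f g] by simp

lemma I_abs: "f \<in> I \<Longrightarrow> (\<lambda>x. \<bar>f x\<bar>) \<in> I"
  by (rule I_dominated[of _ f]) (auto intro: continuous_on_rabs I_cont)

lemma \<Phi>_add: "\<lbrakk>f \<in> I; g \<in> I\<rbrakk> \<Longrightarrow> \<Phi> (\<lambda>x. f x + g x) = \<Phi> f + \<Phi> g"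
  and \<Phi>_scale: "f \<in> I \<Longrightarrow> \<Phi> (\<lambda>x. c * f x) = c * \<Phi> f"
  and \<Phi>_nonneg: "\<lbrakk>f \<in> I; \<And>x. 0 \<le> f x\<rbrakk> \<Longrightarrow> 0 \<le> \<Phi> f"
  using positive unfolding positive_linear_on_def linear_functional_on_def by auto

lemma \<Phi>_minus: "f \<in> I \<Longrightarrow> \<Phi> (\<lambda>x. - f x) = - \<Phi> f" using \<Phi>_scale[of f "-1"] by simp

lemma \<Phi>_diff: "\<lbrakk>f \<in> I; g \<in> I\<rbrakk> \<Longrightarrow> \<Phi> (\<lambda>x. f x - g x) = \<Phi> f - \<Phi> g"
  using \<Phi>_add[OF _ I_minus, of f g] by (simp add: \<Phi>_minus)

lemma \<Phi>_zero: "\<Phi> (\<lambda>x. 0) = 0" using \<Phi>_scale[OF I_zero, of 0] by simp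

lemma \<Phi>_mono: "\<lbrakk>f \<in> I; g \<in> I; \<And>x. f x \<le> g x\<rbrakk> \<Longrightarrow> \<Phi> f \<le> \<Phi> g"
  using \<Phi>_nonneg[OF I_diff, of g f] \<Phi>_diff[of g f] by simp

text \<open>The form in which strict continuity is used: for monotone sequences infima are limits.\<close>

lemma \<Phi>_monotone_convergence:
  assumes u: "\<And>n. u n \<in> I" and dec: "\<And>n x. u (Suc n) x \<le> u n x"
    and lim: "\<And>x. (\<lambda>n. u n x) \<longlonglongrightarrow> 0"
  shows "(\<lambda>n. \<Phi> (u n)) \<longlonglongrightarrow> 0"
proof -
  have decx: "decseq (\<lambda>n. u n x)" for x using dec by (simp add: decseq_Suc_iff)
  have "has_inf (\<lambda>n. u n x) 0" for x
  proof -
    have "0 \<le> u n x" for n using decseq_ge[OF decx lim] .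
    then have bdd: "bdd_below (range (\<lambda>n. u n x))" by (rule bdd_belowI2)
    then show ?thesis
      using LIMSEQ_unique[OF LIMSEQ_decseq_INF[OF bdd decx] lim] by (simp add: has_inf_def)
  qed
  moreover have "decseq u" using dec by (intro decseq_SucI le_funI)
  moreover have "range u \<subseteq> I" using u by blast
  ultimately have inf: "has_inf (\<lambda>n. \<Phi> (u n)) 0"
    using strict unfolding strictly_continuous_on_def by blast
  have "decseq (\<lambda>n. \<Phi> (u n))" using u dec by (auto simp: decseq_Suc_iff intro: \<Phi>_mono)
  with inf show ?thesis
    using LIMSEQ_decseq_INF unfolding has_inf_def by metis
qed

abbreviation IC where "IC \<equiv> complexification I"

lemma IC_cont: "f \<in> IC \<Longrightarrow> continuous_on UNIV f"
proof -
  assume "f \<in> IC"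
  then have "continuous_on UNIV (\<lambda>x. Re (f x))" "continuous_on UNIV (\<lambda>x. Im (f x))"
    using I_cont by (auto simp: complexification_iff)
  then have "continuous_on UNIV (\<lambda>x. Complex (Re (f x)) (Im (f x)))"
    by (rule continuous_on_Complex)
  then show ?thesis by simp
qed

text \<open>The ideal property of \<open>I\<close> carries over to the complexification through \<open>\<bar>f\<bar> \<le> \<bar>Re f\<bar> + \<bar>Im f\<bar>\<close>.\<close>

lemma cmod_mem_I:
  assumes f: "f \<in> IC" shows "(\<lambda>x. cmod (f x)) \<in> I"
proof (rule I_dominated)
  show "continuous_on UNIV (\<lambda>x. cmod (f x))" by (intro continuous_on_norm IC_cont f)
  show "(\<lambda>x. \<bar>Re (f x)\<bar> + \<bar>Im (f x)\<bar>) \<in> I"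
    using f by (auto simp: complexification_iff intro: I_add I_abs)
  show "\<bar>cmod (f x)\<bar> \<le> \<bar>\<bar>Re (f x)\<bar> + \<bar>Im (f x)\<bar>\<bar>" for x
    using cmod_le[of "f x"] by simp
qed

lemma IC_dominated:
  assumes h: "continuous_on UNIV h" and g: "g \<in> IC" and le: "\<And>x. cmod (h x) \<le> cmod (g x)"
  shows "h \<in> IC"
  unfolding complexification_iff
proof
  show "(\<lambda>x. Re (h x)) \<in> I"
    by (rule I_dominated[OF _ cmod_mem_I[OF g]])
      (use h le abs_Re_le_cmod in \<open>auto intro: continuous_on_Re order_trans\<close>)
  show "(\<lambda>x. Im (h x)) \<in> I"
    by (rule I_dominated[OF _ cmod_mem_I[OF g]])
      (use h le abs_Im_le_cmod in \<open>auto intro: continuous_on_Im order_trans\<close>)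
qed

lemma IC_mult: "\<lbrakk>f \<in> IC; g \<in> IC\<rbrakk> \<Longrightarrow> (\<lambda>x. f x * g x) \<in> IC"
  unfolding complexification_iff by (auto intro: I_add I_diff I_mult)

lemma IC_cnj: "f \<in> IC \<Longrightarrow> (\<lambda>x. cnj (f x)) \<in> IC"
  by (simp add: complexification_iff I_minus)

lemma IC_subspace: "fun_subspace IC"
  by (rule fun_subspace_complexification[OF I_subspace])

lemma Re_inner_self: "Re (inner_\<Phi> \<Phi> f f) = \<Phi> (\<lambda>x. (cmod (f x))\<^sup>2)"
proof -
  have "Re (cnj z * z) = (cmod z)\<^sup>2" for z
    using complex_norm_square[of z] by (metis Re_complex_of_real mult.commute)
  then show ?thesis by (simp add: inner_\<Phi>_def complex_extension_def)
qed

lemma complex_extension_add: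
  "f \<in> IC \<Longrightarrow> g \<in> IC \<Longrightarrow>
    complex_extension \<Phi> (\<lambda>x. f x + g x) = complex_extension \<Phi> f + complex_extension \<Phi> g"
  by (simp add: complex_extension_def complexification_iff \<Phi>_add algebra_simps)

lemma complex_extension_scale:
  "f \<in> IC \<Longrightarrow> complex_extension \<Phi> (\<lambda>x. c * f x) = c * complex_extension \<Phi> f"
  by (simp add: complex_extension_def complexification_iff \<Phi>_add \<Phi>_diff \<Phi>_scale I_scale
      complex_eq_iff)

lemma semi_inner_subspace:
  assumes "fun_subspace B" "B \<subseteq> IC"
  shows "semi_inner \<Phi> B"
proof
  show "fun_subspace B" by fact
  fix f assume "f \<in> B"
  then have f: "f \<in> IC" using assms by blast
  show "0 \<le> Re (inner_\<Phi> \<Phi> f f)"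
    unfolding Re_inner_self power2_eq_square using f by (intro \<Phi>_nonneg I_mult cmod_mem_I) auto
  fix g assume "g \<in> B"
  then have g: "g \<in> IC" using assms by blast
  note fg = IC_mult[OF IC_cnj[OF f] g]
  show "inner_\<Phi> \<Phi> f (\<lambda>x. c * g x) = c * inner_\<Phi> \<Phi> f g" for c
    using complex_extension_scale[OF fg, of c] by (simp add: inner_\<Phi>_def mult.left_commute)
  have "(\<lambda>x. Re (cnj (g x) * f x)) = (\<lambda>x. Re (cnj (f x) * g x))"
    "(\<lambda>x. Im (cnj (g x) * f x)) = (\<lambda>x. - Im (cnj (f x) * g x))"
    by (simp_all add: fun_eq_iff algebra_simps)
  then show "inner_\<Phi> \<Phi> g f = cnj (inner_\<Phi> \<Phi> f g)"
    using fg by (simp only: inner_\<Phi>_def complex_extension_def complexification_iff \<Phi>_minus)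
      (simp add: complex_eq_iff)
  fix h assume "h \<in> B"
  then have "h \<in> IC" using assms by blast
  then show "inner_\<Phi> \<Phi> f (\<lambda>x. g x + h x) = inner_\<Phi> \<Phi> f g + inner_\<Phi> \<Phi> f h"
    using complex_extension_add[OF fg IC_mult[OF IC_cnj[OF f]], of h]
    by (simp add: inner_\<Phi>_def distrib_left)
qed

sublocale L2: semi_inner \<Phi> IC
  by (rule semi_inner_subspace[OF IC_subspace order_refl])

lemma norm_\<Phi>_sq: "f \<in> IC \<Longrightarrow> (norm_\<Phi> \<Phi> f)\<^sup>2 = \<Phi> (\<lambda>x. (cmod (f x))\<^sup>2)"
  by (simp add: L2.nm_sq Re_inner_self)

lemma norm_\<Phi>_mono:
  assumes "f \<in> IC" "g \<in> IC" "\<And>x. cmod (f x) \<le> cmod (g x)"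
  shows "norm_\<Phi> \<Phi> f \<le> norm_\<Phi> \<Phi> g"
proof (rule power2_le_imp_le)
  show "(norm_\<Phi> \<Phi> f)\<^sup>2 \<le> (norm_\<Phi> \<Phi> g)\<^sup>2"
    unfolding norm_\<Phi>_sq[OF assms(1)] norm_\<Phi>_sq[OF assms(2)]
    unfolding power2_eq_square
    using assms by (intro \<Phi>_mono I_mult cmod_mem_I mult_mono) auto
qed (use L2.nm_ge0 assms in blast)

end

section \<open>Tightness\<close>

lemma Lindelof_countable_choice:
  fixes U :: "'a::topological_space \<Rightarrow> 'a set"
  assumes L: "Lindelof_space (euclidean :: 'a topology)" and U: "\<And>y. open (U y)" "\<And>y. y \<in> U y"
  obtains p :: "nat \<Rightarrow> 'a" where "\<And>x. \<exists>n. x \<in> U (p n)"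
proof -
  have "(\<forall>V\<in>range U. openin euclidean V) \<and> \<Union>(range U) = topspace euclidean"
    using U by auto
  then obtain \<V> where V: "countable \<V>" "\<V> \<subseteq> range U" "\<Union>\<V> = (UNIV :: 'a set)"
    using L unfolding Lindelof_space_def topspace_euclidean by metis
  then have ne: "\<V> \<noteq> {}" by auto
  have "from_nat_into \<V> n \<in> range U" for n using V(2) from_nat_into[OF ne] by blast
  then have "\<forall>n. \<exists>y. from_nat_into \<V> n = U y" by blast
  then obtain p where p: "\<And>n. from_nat_into \<V> n = U (p n)" by metis
  have "\<exists>n. x \<in> U (p n)" for x
  proof -
    have "x \<in> \<Union>\<V>" unfolding V(3) by (rule UNIV_I)
    then obtain W where W: "W \<in> \<V>" "x \<in> W" by (rule UnionE)
    then have "x \<in> U (p (to_nat_on \<V> W))"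
      using p[of "to_nat_on \<V> W"] from_nat_into_to_nat_on[OF V(1) W(1)] by simp
    then show ?thesis by blast
  qed
  then show thesis by (rule that)
qed

text \<open>A locally compact Hausdorff space is completely regular.\<close>

lemma compact_bump:
  fixes x :: "'a::t2_space"
  assumes lc: "locally_compact_space (euclidean :: 'a topology)"
  shows "\<exists>f K. continuous_on UNIV f \<and> f x = (0::real) \<and> compact K \<and> (\<forall>y. y \<notin> K \<longrightarrow> f y = 1)"
proof -
  have "Hausdorff_space (euclidean :: 'a topology)"
    using hausdorff by (fastforce simp: Hausdorff_space_def disjnt_def)
  then have cr: "completely_regular_space (euclidean :: 'a topology)"
    using lc locally_compact_regular_imp_completely_regular_space by blast
  have "\<exists>U K. openin euclidean U \<and> compactin euclidean K \<and> x \<in> U \<and> U \<subseteq> K"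
    using lc[unfolded locally_compact_space_def, THEN bspec, of x] by simp
  then obtain U K where UK: "open U" "compact K" "x \<in> U" "U \<subseteq> K"
    unfolding open_openin[symmetric] compactin_euclidean_iff by blast
  have "\<exists>f. continuous_map euclidean euclideanreal f \<and> f x = 0 \<and> f ` (topspace euclidean - U) \<subseteq> {1}"
    using cr[unfolded completely_regular_space_alt', rule_format, of U x] UK by simp
  then obtain f where f: "continuous_map euclidean euclideanreal f" "f x = 0"
    "f ` (topspace euclidean - U) \<subseteq> {1}" by blast
  have "continuous_on UNIV f" using f(1) by simp
  moreover have "\<forall>y. y \<notin> K \<longrightarrow> f y = 1" using f(3) UK(4) by auto
  ultimately show ?thesis using f(2) UK(2) by blast
qed

context daniell
begin

lemma I_bounded: "\<lbrakk>continuous_on UNIV f; \<And>x. \<bar>f x\<bar> \<le> C\<rbrakk> \<Longrightarrow> f \<in> I"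
  by (rule I_dominated[OF _ I_const[of C]]) (auto intro: order_trans[OF _ abs_ge_self])

text \<open>Tightness of the functional: up to arbitrarily small mass it lives on a compact set. Countably
  many of the sets \<open>{f x < 1/2}\<close> cover the space. On each of them the truncation \<open>g x\<close> of
  \<open>2 * f x - 1\<close> vanishes, and off the compact set \<open>C x\<close> it is \<open>1\<close>. Hence the partial products of
  the \<open>g x\<close> decrease to \<open>0\<close> pointwise, while each is \<open>1\<close> off a compact set.\<close>

lemma tight:
  assumes L: "Lindelof_space (euclidean :: 'a topology)"
    and lc: "locally_compact_space (euclidean :: 'a topology)"
    and \<delta>: "0 < \<delta>"
  obtains K \<psi> where "compact K" "\<psi> \<in> I" "\<And>x. 0 \<le> \<psi> x" "\<And>x. x \<notin> K \<Longrightarrow> 1 \<le> \<psi> x" "\<Phi> \<psi> < \<delta>"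
proof -
  obtain f :: "'a \<Rightarrow> 'a \<Rightarrow> real" and C :: "'a \<Rightarrow> 'a set"
    where f: "\<And>x. continuous_on UNIV (f x)" "\<And>x. f x x = 0"
    and C: "\<And>x. compact (C x)" "\<And>x y. y \<notin> C x \<Longrightarrow> f x y = 1"
    using compact_bump[OF lc] by metis
  define U where "U x = {y. f x y < 1/2}" for x
  have "open (U x)" for x
    unfolding U_def by (rule open_Collect_less[OF f(1) continuous_on_const])
  moreover have "x \<in> U x" for x by (simp add: U_def f)
  ultimately obtain p :: "nat \<Rightarrow> 'a" where p: "\<And>x. \<exists>n. x \<in> U (p n)"
    using Lindelof_countable_choice[OF L] by metis
  define g where "g x y = max 0 (min 1 (2 * f x y - 1))" for x y
  define u where "u n y = (\<Prod>i\<le>n. g (p i) y)" for n y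
  have g01: "0 \<le> g x y" "g x y \<le> 1" for x y by (auto simp: g_def)
  have u01: "0 \<le> u n y" "u n y \<le> 1" for n y
    using g01 by (auto simp: u_def intro: prod_nonneg prod_le_1)
  have uI: "u n \<in> I" for n
  proof (rule I_bounded)
    show "continuous_on UNIV (u n)"
      unfolding u_def[abs_def] g_def by (intro continuous_intros f)
    show "\<bar>u n y\<bar> \<le> 1" for y using u01 by simp
  qed
  have "(\<lambda>n. \<Phi> (u n)) \<longlonglongrightarrow> 0"
  proof (rule \<Phi>_monotone_convergence[OF uI])
    show "u (Suc n) y \<le> u n y" for n y
      using u01(1)[of n y] g01(2)[of "p (Suc n)" y] by (simp add: u_def mult_left_le)
    fix y
    obtain n where n: "y \<in> U (p n)" using p by blast
    then have "g (p n) y = 0" by (simp add: U_def g_def)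
    then have "u m y = 0" if "n \<le> m" for m using that by (auto simp: u_def intro!: prod_zero bexI[of _ n])
    then show "(\<lambda>n. u n y) \<longlonglongrightarrow> 0"
      by (intro tendsto_eventually) (auto simp: eventually_sequentially)
  qed
  from LIMSEQ_D[OF this \<delta>] obtain n where n: "\<bar>\<Phi> (u n)\<bar> < \<delta>" by auto
  show thesis
  proof (rule that[of "\<Union>i\<le>n. C (p i)" "u n"])
    show "compact (\<Union>i\<le>n. C (p i))" by (intro compact_UN C) auto
    show "1 \<le> u n x" if "x \<notin> (\<Union>i\<le>n. C (p i))" for x
      using that C(2) by (simp add: u_def g_def)
  qed (use uI u01 n in auto)
qed

end

section \<open>Multipliers of closed subspaces\<close>

locale closed_subspace = daniell I \<Phi>
  for I :: "('a::t2_space \<Rightarrow> real) set" and \<Phi> :: "('a \<Rightarrow> real) \<Rightarrow> real" +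
  fixes N :: "('a \<Rightarrow> complex) set"
  assumes N_subspace: "fun_subspace N" and N_subset: "N \<subseteq> complexification I"
    and N_closed: "\<lbrakk>f \<in> complexification I; \<And>\<epsilon>. 0 < \<epsilon> \<Longrightarrow> \<exists>b\<in>N. norm_\<Phi> \<Phi> (\<lambda>x. f x - b x) < \<epsilon>\<rbrakk> \<Longrightarrow> f \<in> N"
begin

lemma N_IC: "f \<in> N \<Longrightarrow> f \<in> IC" using N_subset by blast

lemma N_add: "\<lbrakk>f \<in> N; g \<in> N\<rbrakk> \<Longrightarrow> (\<lambda>x. f x + g x) \<in> N"
  and N_scale: "f \<in> N \<Longrightarrow> (\<lambda>x. c * f x) \<in> N"
  using N_subspace unfolding fun_subspace_def by auto

text \<open>For a norm closed \<open>N\<close> these functions form an algebra which is stable under composition with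
  continuous functions, even when \<open>N\<close> is only a vector space. Passing from \<open>N\<close> to its multipliers
  is what makes the Stone-Weierstrass theorem applicable.\<close>

definition multipliers :: "('a \<Rightarrow> real) set" where
  "multipliers = {h. continuous_on UNIV h \<and> (\<exists>C. \<forall>x. \<bar>h x\<bar> \<le> C)
     \<and> (\<forall>f\<in>N. (\<lambda>x. of_real (h x) * f x) \<in> N)}"

text \<open>Uniform approximation of bounded functions gives norm approximation of the products.\<close>

lemma mult_bounded:
  assumes h: "continuous_on UNIV h" "\<And>x. \<bar>h x\<bar> \<le> C" and f: "f \<in> IC"
  shows "(\<lambda>x. of_real (h x) * f x) \<in> IC" "norm_\<Phi> \<Phi> (\<lambda>x. of_real (h x) * f x) \<le> C * norm_\<Phi> \<Phi> f"
proof -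
  have C: "0 \<le> C" using h(2) abs_ge_zero order_trans by blast
  have Cf: "(\<lambda>x. of_real C * f x) \<in> IC" by (rule L2.scale_mem[OF f])
  have le: "cmod (of_real (h x) * f x) \<le> cmod (of_real C * f x)" for x
    using h(2)[of x] C by (simp add: norm_mult mult_right_mono)
  show *: "(\<lambda>x. of_real (h x) * f x) \<in> IC"
    by (rule IC_dominated[OF _ Cf le]) (intro continuous_on_mult continuous_on_of_real h IC_cont f)
  show "norm_\<Phi> \<Phi> (\<lambda>x. of_real (h x) * f x) \<le> C * norm_\<Phi> \<Phi> f"
    using norm_\<Phi>_mono[OF * Cf le] L2.nm_scale[OF f, of "of_real C"] C by simp
qed

lemma multipliers_const: "(\<lambda>x. c) \<in> multipliers"
  using N_scale by (auto simp: multipliers_def)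

lemma multipliers_add: 
  assumes "g \<in> multipliers" "h \<in> multipliers" shows "(\<lambda>x. g x + h x) \<in> multipliers"
proof -
  obtain C D where "\<And>x. \<bar>g x\<bar> \<le> C" "\<And>x. \<bar>h x\<bar> \<le> D" using assms by (auto simp: multipliers_def)
  then have "\<bar>g x + h x\<bar> \<le> C + D" for x by (meson abs_triangle_ineq add_mono order_trans)
  moreover have "continuous_on UNIV (\<lambda>x. g x + h x)"
    using assms by (auto simp: multipliers_def intro: continuous_on_add)
  moreover have "(\<lambda>x. of_real (g x + h x) * f x) \<in> N" if "f \<in> N" for f
    using N_add[of "\<lambda>x. of_real (g x) * f x" "\<lambda>x. of_real (h x) * f x"] assms that
    by (simp add: multipliers_def distrib_right)
  ultimately show ?thesis unfolding multipliers_def by blast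
qed

lemma multipliers_mult: 
  assumes "g \<in> multipliers" "h \<in> multipliers" shows "(\<lambda>x. g x * h x) \<in> multipliers"
proof -
  obtain C D where CD: "\<And>x. \<bar>g x\<bar> \<le> C" "\<And>x. \<bar>h x\<bar> \<le> D" using assms by (auto simp: multipliers_def)
  have "\<bar>g x * h x\<bar> \<le> C * D" for x
    unfolding abs_mult using CD[of x] by (intro mult_mono) auto
  moreover have "continuous_on UNIV (\<lambda>x. g x * h x)"
    using assms by (auto simp: multipliers_def intro: continuous_on_mult)
  moreover have "(\<lambda>x. of_real (g x * h x) * f x) \<in> N" if f: "f \<in> N" for f
  proof -
    have "(\<lambda>x. of_real (h x) * f x) \<in> N" using assms f by (simp add: multipliers_def)
    then have "(\<lambda>x. of_real (g x) * (of_real (h x) * f x)) \<in> N"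
      using assms(1) by (simp add: multipliers_def)
    then show ?thesis by (simp add: mult.assoc)
  qed
  ultimately show ?thesis unfolding multipliers_def by blast
qed

lemma multipliers_polynomial:
  assumes h: "h \<in> multipliers" and "real_polynomial_function (q :: real \<Rightarrow> real)"
  shows "(\<lambda>x. q (h x)) \<in> multipliers"
  using assms(2)
proof induction
  case (linear l)
  have "l t = t * l 1" for t
    using linear_scale[OF bounded_linear.linear[OF linear], of t 1] by simp
  then have "(\<lambda>x. l (h x)) = (\<lambda>x. h x * l 1)" by blast
  then show ?case using multipliers_mult[OF h multipliers_const[of "l 1"]] by simp
qed (simp_all add: multipliers_const multipliers_add multipliers_mult)

text \<open>On the bounded range of \<open>h\<close>, \<open>\<phi>\<close> is a uniform limit of polynomials, and \<open>N\<close> is closed.\<close>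

lemma multipliers_compose:
  assumes h: "h \<in> multipliers" and \<phi>: "continuous_on UNIV (\<phi> :: real \<Rightarrow> real)"
  shows "(\<lambda>x. \<phi> (h x)) \<in> multipliers"
proof -
  obtain C where C: "\<And>x. \<bar>h x\<bar> \<le> C" using h by (auto simp: multipliers_def)
  have hC: "h x \<in> {- C..C}" for x using C[of x] by auto
  have hcont: "continuous_on UNIV h" using h by (simp add: multipliers_def)
  have \<phi>C: "continuous_on {-C..C} \<phi>" using \<phi> continuous_on_subset by blast
  have cont: "continuous_on UNIV (\<lambda>x. \<phi> (h x))"
    using continuous_on_compose2[OF \<phi> hcont] by simp
  have "bounded (\<phi> ` {-C..C})"
    by (intro compact_imp_bounded compact_continuous_image \<phi>C compact_Icc)
  then obtain D where "\<And>t. t \<in> {-C..C} \<Longrightarrow> \<bar>\<phi> t\<bar> \<le> D"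
    unfolding bounded_iff real_norm_def by blast
  then have D: "\<bar>\<phi> (h x)\<bar> \<le> D" for x using hC by blast
  have "(\<lambda>x. of_real (\<phi> (h x)) * f x) \<in> N" if f: "f \<in> N" for f
  proof (rule N_closed[OF mult_bounded(1)[OF cont D N_IC[OF f]]])
    fix \<epsilon> :: real assume \<epsilon>: "0 < \<epsilon>"
    have nf: "0 \<le> norm_\<Phi> \<Phi> f" using L2.nm_ge0 N_IC f by blast
    define e where "e = \<epsilon> / (norm_\<Phi> \<Phi> f + 1)"
    have e: "0 < e" using \<epsilon> nf by (simp add: e_def)
    obtain q where q: "real_polynomial_function q" and qe: "\<And>t. t \<in> {-C..C} \<Longrightarrow> \<bar>\<phi> t - q t\<bar> < e"
      using Stone_Weierstrass_real_polynomial_function[OF compact_Icc \<phi>C e] by blast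
    have qh: "(\<lambda>x. q (h x)) \<in> multipliers" by (rule multipliers_polynomial[OF h q])
    have "norm_\<Phi> \<Phi> (\<lambda>x. of_real (\<phi> (h x) - q (h x)) * f x) \<le> e * norm_\<Phi> \<Phi> f"
    proof (rule mult_bounded(2)[OF _ _ N_IC[OF f]])
      show "continuous_on UNIV (\<lambda>x. \<phi> (h x) - q (h x))"
        using cont qh by (auto simp: multipliers_def intro: continuous_on_diff)
      show "\<bar>\<phi> (h x) - q (h x)\<bar> \<le> e" for x using qe[OF hC, of x] by simp
    qed
    also have "\<dots> < \<epsilon>"
    proof -
      have "e * norm_\<Phi> \<Phi> f < e * (norm_\<Phi> \<Phi> f + 1)" using e by simp
      also have "\<dots> = \<epsilon>" using nf by (simp add: e_def)
      finally show ?thesis .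
    qed
    finally have "norm_\<Phi> \<Phi> (\<lambda>x. of_real (\<phi> (h x)) * f x - of_real (q (h x)) * f x) < \<epsilon>"
      by (simp add: left_diff_distrib)
    moreover have "(\<lambda>x. of_real (q (h x)) * f x) \<in> N" using qh f by (simp add: multipliers_def)
    ultimately show "\<exists>b\<in>N. norm_\<Phi> \<Phi> (\<lambda>x. of_real (\<phi> (h x)) * f x - b x) < \<epsilon>"
      by (rule bexI)
  qed
  then show ?thesis using cont D unfolding multipliers_def by auto
qed

text \<open>Let \<open>f\<close> be real and bounded by \<open>C\<close>. On a compact set \<open>K\<close> carrying most of the mass, the
  Stone-Weierstrass theorem gives a multiplier \<open>g\<close> near \<open>f\<close>; off \<open>K\<close> it may be large, but its
  truncation \<open>h\<close> to \<open>{-C..C}\<close> is again a multiplier and differs from \<open>f\<close> by at most \<open>2 * C\<close> there.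
  So \<open>h = h \<cdot> 1\<close> is an element of \<open>N\<close> near \<open>f\<close> in norm. An unbounded \<open>f\<close> is the norm limit of its
  truncations by monotone convergence.\<close>

lemma N_eq_IC:
  assumes L: "Lindelof_space (euclidean :: 'a topology)"
    and lc: "locally_compact_space (euclidean :: 'a topology)"
    and one: "(\<lambda>x. 1) \<in> N"
    and sep: "\<And>x y. x \<noteq> y \<Longrightarrow> \<exists>h\<in>multipliers. h x \<noteq> h y"
  shows "N = IC"
proof -
  have real_IC: "of_real_fun f \<in> IC" if "f \<in> I" for f
    by (rule of_real_fun_mem_complexification[OF I_subspace that])
  have norm_real: "(norm_\<Phi> \<Phi> (\<lambda>x. of_real_fun f x - of_real_fun h x))\<^sup>2 = \<Phi> (\<lambda>x. (f x - h x)\<^sup>2)"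
    if "f \<in> I" "h \<in> I" for f h
  proof -
    have "(cmod (complex_of_real (f x) - complex_of_real (h x)))\<^sup>2 = (f x - h x)\<^sup>2" for x
      by (metis norm_of_real of_real_diff power2_abs)
    then show ?thesis
      using norm_\<Phi>_sq[OF L2.diff_mem[OF real_IC real_IC], OF that] by (simp add: of_real_fun_def)
  qed
  have small: "norm_\<Phi> \<Phi> (\<lambda>x. of_real_fun f x - of_real_fun h x) < \<epsilon>"
    if "f \<in> I" "h \<in> I" "\<Phi> (\<lambda>x. (f x - h x)\<^sup>2) < \<epsilon>\<^sup>2" "0 < \<epsilon>" for f h \<epsilon>
    using power2_less_imp_less[of "norm_\<Phi> \<Phi> (\<lambda>x. of_real_fun f x - of_real_fun h x)" \<epsilon>]
      norm_real that by simp
  have bounded: "of_real_fun f \<in> N" if f: "continuous_on UNIV f" and C: "\<And>x. \<bar>f x\<bar> \<le> C" for f C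
  proof -
    have fI: "f \<in> I" by (rule I_bounded[OF f C])
    have C0: "0 \<le> C" using C[of undefined] by (meson abs_ge_zero order_trans)
    show ?thesis
    proof (rule N_closed[OF real_IC[OF fI]])
      fix \<epsilon> :: real assume \<epsilon>: "0 < \<epsilon>"
      have \<Phi>1: "0 \<le> \<Phi> (\<lambda>x. 1)" by (rule \<Phi>_nonneg[OF I_one]) simp
      \<comment> \<open>The bound \<open>e\<^sup>2 * \<Phi> 1 + (2 * C)\<^sup>2 * \<delta>\<close> has to be less than \<open>\<epsilon>\<^sup>2\<close>; each summand gets half of it,
        and the summands \<open>1\<close> in the denominators avoid division by zero.\<close>
      define \<delta> where "\<delta> = \<epsilon>\<^sup>2 / (2 * ((2 * C)\<^sup>2 + 1))"
      define e where "e = \<epsilon> / sqrt (2 * (\<Phi> (\<lambda>x. 1) + 1))"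
      have e: "0 < e" using \<epsilon> \<Phi>1 by (simp add: e_def)
      have \<delta>: "0 < \<delta>" unfolding \<delta>_def using \<epsilon> by (intro divide_pos_pos mult_pos_pos add_nonneg_pos) auto
      obtain K \<psi> where K: "compact K" and \<psi>: "\<psi> \<in> I" "\<And>x. 0 \<le> \<psi> x" "\<And>x. x \<notin> K \<Longrightarrow> 1 \<le> \<psi> x"
        "\<Phi> \<psi> < \<delta>"
        using tight[OF L lc \<delta>] by metis
      interpret SW: function_ring_on multipliers K
      proof
        show "compact K" by (rule K)
        show "g \<in> multipliers \<Longrightarrow> continuous_on K g" for g
          by (auto simp: multipliers_def intro: continuous_on_subset)
      qed (use multipliers_add multipliers_mult multipliers_const sep in auto)
      obtain g where g: "g \<in> multipliers" and gf: "\<And>x. x \<in> K \<Longrightarrow> \<bar>f x - g x\<bar> < e"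
        using SW.Stone_Weierstrass_basic[OF continuous_on_subset[OF f] e] by auto
      define h where "h x = max (- C) (min C (g x))" for x
      have h: "h \<in> multipliers"
        unfolding h_def[abs_def]
        by (rule multipliers_compose[OF g, of "\<lambda>t. max (- C) (min C t)"]) (intro continuous_intros)
      have hI: "h \<in> I"
        using h I_bounded unfolding multipliers_def by blast
      have "(f x - h x)\<^sup>2 \<le> e\<^sup>2 * 1 + (2 * C)\<^sup>2 * \<psi> x" for x
      proof (cases "x \<in> K")
        case True
        have "\<bar>f x - h x\<bar> \<le> \<bar>e\<bar>" using gf[OF True] C[of x] e unfolding h_def by (auto simp: max_def min_def)
        then show ?thesis using \<psi>(2)[of x] by (simp add: abs_le_square_iff add_increasing2)
      next
        case False
        have "\<bar>f x - h x\<bar> \<le> \<bar>2 * C\<bar>" using C[of x] C0 unfolding h_def by (auto simp: max_def min_def)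
        then have "(f x - h x)\<^sup>2 \<le> (2 * C)\<^sup>2" by (simp only: abs_le_square_iff)
        also have "\<dots> \<le> (2 * C)\<^sup>2 * \<psi> x" using mult_left_mono[OF \<psi>(3)[OF False], of "(2 * C)\<^sup>2"] by simp
        finally show ?thesis by (simp add: add_increasing)
      qed
      then have "\<Phi> (\<lambda>x. (f x - h x)\<^sup>2) \<le> \<Phi> (\<lambda>x. e\<^sup>2 * 1 + (2 * C)\<^sup>2 * \<psi> x)"
        unfolding power2_eq_square[of "f _ - h _"]
        by (intro \<Phi>_mono I_mult I_diff I_add I_scale I_one fI hI \<psi>) auto
      also have "\<dots> = e\<^sup>2 * \<Phi> (\<lambda>x. 1) + (2 * C)\<^sup>2 * \<Phi> \<psi>"
        by (simp only: \<Phi>_add[OF I_scale[OF I_one] I_scale[OF \<psi>(1)]] \<Phi>_scale[OF I_one] \<Phi>_scale[OF \<psi>(1)])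
      also have "\<dots> < \<epsilon>\<^sup>2"
      proof -
        have "e\<^sup>2 * \<Phi> (\<lambda>x. 1) = \<epsilon>\<^sup>2 / 2 * (\<Phi> (\<lambda>x. 1) / (\<Phi> (\<lambda>x. 1) + 1))"
          using \<Phi>1 by (simp add: e_def power_divide)
        also have "\<dots> \<le> \<epsilon>\<^sup>2 / 2 * 1" using \<Phi>1 by (intro mult_left_mono) auto
        finally have a: "e\<^sup>2 * \<Phi> (\<lambda>x. 1) \<le> \<epsilon>\<^sup>2 / 2" by simp
        have "(2 * C)\<^sup>2 * \<Phi> \<psi> \<le> (2 * C)\<^sup>2 * \<delta>" using \<psi>(4) by (intro mult_left_mono) auto
        also have "\<dots> < ((2 * C)\<^sup>2 + 1) * \<delta>" using \<delta> by simp
        also have "\<dots> = \<epsilon>\<^sup>2 / 2"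
        proof -
          have "u * (\<epsilon>\<^sup>2 / (2 * u)) = \<epsilon>\<^sup>2 / 2" if "u \<noteq> 0" for u using that by simp
          moreover have "(2 * C)\<^sup>2 + 1 \<noteq> 0" by (smt (verit) zero_le_power2)
          ultimately show ?thesis unfolding \<delta>_def by blast
        qed
        finally show ?thesis using a by simp
      qed
      finally have "norm_\<Phi> \<Phi> (\<lambda>x. of_real_fun f x - of_real_fun h x) < \<epsilon>"
        by (intro small fI hI \<epsilon>)
      moreover have "of_real_fun h \<in> N"
        using h one by (auto simp: multipliers_def of_real_fun_def[abs_def] dest: bspec[of _ _ "\<lambda>x. 1"])
      ultimately show "\<exists>b\<in>N. norm_\<Phi> \<Phi> (\<lambda>x. of_real_fun f x - b x) < \<epsilon>" by blast
    qed
  qed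
  have real: "of_real_fun f \<in> N" if fI: "f \<in> I" for f
  proof (rule N_closed[OF real_IC[OF fI]])
    fix \<epsilon> :: real assume \<epsilon>: "0 < \<epsilon>"
    define t where "t n x = max (- real n) (min (real n) (f x))" for n x
    have tc: "continuous_on UNIV (t n)" for n
      unfolding t_def[abs_def] by (intro continuous_intros I_cont fI)
    have tb: "\<bar>t n x\<bar> \<le> real n" for n x by (auto simp: t_def)
    have tI: "t n \<in> I" for n by (rule I_bounded[OF tc tb])
    have "(\<lambda>n. \<Phi> (\<lambda>x. (f x - t n x)\<^sup>2)) \<longlonglongrightarrow> 0"
    proof (rule \<Phi>_monotone_convergence)
      show "(\<lambda>x. (f x - t n x)\<^sup>2) \<in> I" for n
        unfolding power2_eq_square by (intro I_mult I_diff fI tI)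
      show "(f x - t (Suc n) x)\<^sup>2 \<le> (f x - t n x)\<^sup>2" for n x
        by (subst abs_le_square_iff[symmetric]) (auto simp: t_def max_def min_def)
      fix x
      obtain n where n: "\<bar>f x\<bar> \<le> real n" using real_arch_simple by blast
      have "(f x - t m x)\<^sup>2 = 0" if "n \<le> m" for m
        using n that by (simp add: t_def)
      then show "(\<lambda>n. (f x - t n x)\<^sup>2) \<longlonglongrightarrow> 0"
        by (intro tendsto_eventually) (auto simp: eventually_sequentially)
    qed
    from LIMSEQ_D[OF this, of "\<epsilon>\<^sup>2"] \<epsilon> obtain n where "\<bar>\<Phi> (\<lambda>x. (f x - t n x)\<^sup>2)\<bar> < \<epsilon>\<^sup>2" by auto
    then have "norm_\<Phi> \<Phi> (\<lambda>x. of_real_fun f x - of_real_fun (t n) x) < \<epsilon>"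
      by (intro small fI tI \<epsilon>) simp
    then show "\<exists>b\<in>N. norm_\<Phi> \<Phi> (\<lambda>x. of_real_fun f x - b x) < \<epsilon>"
      using bounded[OF tc tb] by blast
  qed
  show ?thesis
  proof
    show "IC \<subseteq> N"
    proof
      fix f assume "f \<in> IC"
      then obtain r i where f: "f = (\<lambda>x. of_real_fun r x + \<i> * of_real_fun i x)" "r \<in> I" "i \<in> I"
        by (auto simp: complexification_def)
      show "f \<in> N" unfolding f(1) by (intro N_add N_scale real f)
    qed
  qed (rule N_subset)
qed

end

section \<open>Multiplication operators and their resolvents\<close>

lemma seminorm_closure_eqI:
  assumes "\<And>f \<epsilon>. \<lbrakk>f \<in> V; 0 < \<epsilon>\<rbrakk> \<Longrightarrow> \<exists>b\<in>B. p (\<lambda>x. f x - b x) < \<epsilon>"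
  shows "seminorm_closure p V B = V"
  using assms by (auto simp: seminorm_closure_def)

lemma seminorm_closureE:
  assumes "f \<in> seminorm_closure p V B" "0 < \<epsilon>"
  obtains b where "b \<in> B" "p (\<lambda>x. f x - b x) < \<epsilon>"
  using assms unfolding seminorm_closure_def mem_Collect_eq by meson

lemma (in symmetric_operator) dense_rangeE:
  assumes "dense_range z" "p \<in> B" "0 < \<epsilon>"
  obtains c where "c \<in> B" "nm (\<lambda>x. p x - (a x * c x + z * c x)) < \<epsilon>"
  using assms unfolding dense_range_def by meson

lemma (in daniell) closed_subspace_closure:
  assumes B: "fun_subspace B" "B \<subseteq> IC"
  shows "closed_subspace I \<Phi> (seminorm_closure (norm_\<Phi> \<Phi>) IC B)" (is "closed_subspace I \<Phi> ?N")
proof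
  have B_mem: "(\<lambda>x. 0) \<in> B" "\<And>f g. f \<in> B \<Longrightarrow> g \<in> B \<Longrightarrow> (\<lambda>x. f x + g x) \<in> B"
    "\<And>c f. f \<in> B \<Longrightarrow> (\<lambda>x. c * f x) \<in> B"
    using B(1) unfolding fun_subspace_def by auto
  have BI: "b \<in> IC" if "b \<in> B" for b using that B(2) by blast
  have NI: "?N \<subseteq> IC" by (auto simp: seminorm_closure_def)
  then show "?N \<subseteq> complexification I" .
  have near: "\<exists>b\<in>B. norm_\<Phi> \<Phi> (\<lambda>x. f x - b x) < \<epsilon>" if "f \<in> ?N" "0 < \<epsilon>" for f \<epsilon>
    using that by (simp add: seminorm_closure_def)
  have N_I: "f \<in> ?N" if "f \<in> IC" "\<And>\<epsilon>. 0 < \<epsilon> \<Longrightarrow> \<exists>b\<in>B. norm_\<Phi> \<Phi> (\<lambda>x. f x - b x) < \<epsilon>" for f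
    using that by (simp add: seminorm_closure_def)
  show "f \<in> ?N" if f: "f \<in> complexification I"
    and ex: "\<And>\<epsilon>. 0 < \<epsilon> \<Longrightarrow> \<exists>b\<in>?N. norm_\<Phi> \<Phi> (\<lambda>x. f x - b x) < \<epsilon>" for f
  proof (rule N_I[OF f])
    fix \<epsilon> :: real assume "0 < \<epsilon>"
    then have e: "0 < \<epsilon> / 2" by simp
    obtain g where g: "g \<in> ?N" "norm_\<Phi> \<Phi> (\<lambda>x. f x - g x) < \<epsilon> / 2" using ex[OF e] by blast
    obtain b where b: "b \<in> B" "norm_\<Phi> \<Phi> (\<lambda>x. g x - b x) < \<epsilon> / 2" using near[OF g(1) e] by blast
    have "g \<in> IC" using g(1) NI by blast
    then have "norm_\<Phi> \<Phi> (\<lambda>x. f x - b x) < \<epsilon>"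
      using L2.nm_diff_triangle[OF f _ BI[OF b(1)], of g] g(2) b(2) by linarith
    then show "\<exists>b\<in>B. norm_\<Phi> \<Phi> (\<lambda>x. f x - b x) < \<epsilon>" using b(1) by blast
  qed
  show "fun_subspace ?N"
    unfolding fun_subspace_def
  proof (intro conjI ballI allI)
    show "(\<lambda>x. 0) \<in> ?N"
    proof (rule N_I[OF L2.zero_mem])
      show "\<exists>b\<in>B. norm_\<Phi> \<Phi> (\<lambda>x. 0 - b x) < \<epsilon>" if "0 < \<epsilon>" for \<epsilon>
        using B_mem(1) that L2.nm_zero by (intro bexI[of _ "\<lambda>x. 0"]) auto
    qed
    fix f assume f: "f \<in> ?N"
    then have fI: "f \<in> IC" using NI by blast
    show "(\<lambda>x. f x + g x) \<in> ?N" if g: "g \<in> ?N" for g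
    proof -
      have gI: "g \<in> IC" using g NI by blast
      show ?thesis
      proof (rule N_I[OF L2.add_mem[OF fI gI]])
        fix \<epsilon> :: real assume "0 < \<epsilon>"
        then have e: "0 < \<epsilon> / 2" by simp
        obtain b where b: "b \<in> B" "norm_\<Phi> \<Phi> (\<lambda>x. f x - b x) < \<epsilon> / 2" using near[OF f e] by blast
        obtain c where c: "c \<in> B" "norm_\<Phi> \<Phi> (\<lambda>x. g x - c x) < \<epsilon> / 2" using near[OF g e] by blast
        have "norm_\<Phi> \<Phi> (\<lambda>x. (f x - b x) + (g x - c x)) < \<epsilon>"
          using L2.nm_triangle[OF L2.diff_mem[OF fI BI[OF b(1)]] L2.diff_mem[OF gI BI[OF c(1)]]]
            b(2) c(2) by linarith
        then have "norm_\<Phi> \<Phi> (\<lambda>x. f x + g x - (b x + c x)) < \<epsilon>" by (simp add: algebra_simps)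
        then show "\<exists>b\<in>B. norm_\<Phi> \<Phi> (\<lambda>x. f x + g x - b x) < \<epsilon>"
          using B_mem(2)[OF b(1) c(1)] by (rule bexI[where x = "\<lambda>x. b x + c x"])
      qed
    qed
    show "(\<lambda>x. c * f x) \<in> ?N" for c
    proof (rule N_I[OF L2.scale_mem[OF fI]])
      fix \<epsilon> :: real assume \<epsilon>: "0 < \<epsilon>"
      have pos: "0 < cmod c + 1" by (simp add: add_nonneg_pos)
      then have e: "0 < \<epsilon> / (cmod c + 1)" using \<epsilon> by simp
      obtain b where b: "b \<in> B" "norm_\<Phi> \<Phi> (\<lambda>x. f x - b x) < \<epsilon> / (cmod c + 1)" using near[OF f e] by blast
      have d: "(\<lambda>x. f x - b x) \<in> IC" by (rule L2.diff_mem[OF fI BI[OF b(1)]])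
      have "norm_\<Phi> \<Phi> (\<lambda>x. c * (f x - b x)) = cmod c * norm_\<Phi> \<Phi> (\<lambda>x. f x - b x)"
        by (rule L2.nm_scale[OF d])
      also have "\<dots> \<le> (cmod c + 1) * norm_\<Phi> \<Phi> (\<lambda>x. f x - b x)"
        using L2.nm_ge0[OF d] by (intro mult_right_mono) auto
      also have "\<dots> < \<epsilon>" using b(2) pos by (simp add: pos_less_divide_eq mult.commute)
      finally have "norm_\<Phi> \<Phi> (\<lambda>x. c * f x - c * b x) < \<epsilon>" by (simp add: right_diff_distrib)
      then show "\<exists>b\<in>B. norm_\<Phi> \<Phi> (\<lambda>x. c * f x - b x) < \<epsilon>"
        using B_mem(3)[OF b(1)] by (rule bexI[where x = "\<lambda>x. c * b x"])
    qed
  qed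
qed

locale multiplication_operator = daniell I \<Phi>
  for I :: "('a::t2_space \<Rightarrow> real) set" and \<Phi> :: "('a \<Rightarrow> real) \<Rightarrow> real" +
  fixes B :: "('a \<Rightarrow> complex) set" and a :: "'a \<Rightarrow> real"
  assumes B_subspace: "fun_subspace B" and B_subset: "B \<subseteq> complexification I"
    and a_mem: "a \<in> I" and B_mult: "f \<in> B \<Longrightarrow> (\<lambda>x. of_real_fun a x * f x) \<in> B"
begin

lemma symmetric_operator_subspace:
  assumes "fun_subspace D" "D \<subseteq> IC" "\<And>f. f \<in> D \<Longrightarrow> (\<lambda>x. of_real_fun a x * f x) \<in> D"
  shows "symmetric_operator \<Phi> D (of_real_fun a)"
proof -
  interpret semi_inner \<Phi> D by (rule semi_inner_subspace[OF assms(1,2)])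
  have "(\<lambda>x. cnj (of_real_fun a x * f x) * g x) = (\<lambda>x. cnj (f x) * (of_real_fun a x * g x))" for f g
    by (simp add: of_real_fun_def fun_eq_iff)
  then show ?thesis by unfold_locales (simp_all add: inner_\<Phi>_def assms(3))
qed

sublocale op: symmetric_operator \<Phi> B "of_real_fun a"
  by (rule symmetric_operator_subspace[OF B_subspace B_subset B_mult])

sublocale full: symmetric_operator \<Phi> IC "of_real_fun a"
  by (rule symmetric_operator_subspace[OF IC_subspace order_refl])
    (intro IC_mult of_real_fun_mem_complexification[OF I_subspace a_mem])

abbreviation L2_closure where "L2_closure \<equiv> seminorm_closure (norm_\<Phi> \<Phi>) IC B"
abbreviation graph_closure where
  "graph_closure \<equiv> seminorm_closure (graph_norm_\<Phi> \<Phi> (of_real_fun a)) IC B"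

lemma B_IC: "b \<in> B \<Longrightarrow> b \<in> IC" using B_subset by blast

lemma shift_ge_1: "z = \<i> \<or> z = - \<i> \<Longrightarrow> 1 \<le> cmod (of_real_fun a x + z)"
  using abs_Im_le_cmod[of "of_real_fun a x + z"] by (auto simp: of_real_fun_def)

lemma shift_nonzero: "z = \<i> \<or> z = - \<i> \<Longrightarrow> of_real_fun a x + z \<noteq> 0"
  using shift_ge_1[of z x] by auto

lemma resolvent_IC:
  assumes z: "z = \<i> \<or> z = - \<i>" and f: "f \<in> IC"
  shows "(\<lambda>x. f x / (of_real_fun a x + z)) \<in> IC"
    and "norm_\<Phi> \<Phi> (\<lambda>x. f x / (of_real_fun a x + z)) \<le> norm_\<Phi> \<Phi> f"
proof -
  have le: "cmod (f x / (of_real_fun a x + z)) \<le> cmod (f x)" for x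
    using shift_ge_1[OF z, of x] by (simp add: norm_divide divide_le_eq mult_left_le_one_le mult_le_cancel_left1)
  have "continuous_on UNIV (\<lambda>x. f x / (of_real_fun a x + z))"
    using shift_nonzero[OF z] unfolding of_real_fun_def
    by (intro continuous_on_divide continuous_on_add continuous_on_of_real continuous_on_const
        IC_cont[OF f] I_cont[OF a_mem]) auto
  then show *: "(\<lambda>x. f x / (of_real_fun a x + z)) \<in> IC" by (rule IC_dominated[OF _ f le])
  show "norm_\<Phi> \<Phi> (\<lambda>x. f x / (of_real_fun a x + z)) \<le> norm_\<Phi> \<Phi> f"
    by (rule norm_\<Phi>_mono[OF * f le])
qed

text \<open>Approximation in the graph norm of \<open>a\<close> is norm approximation after multiplication by \<open>a + z\<close>.
  This links the closures in the theorem to ranges of \<open>a \<plusminus> \<i>\<close>.\<close>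

lemma graph_norm_eq:
  assumes "f \<in> IC" "z = \<i> \<or> z = - \<i>"
  shows "graph_norm_\<Phi> \<Phi> (of_real_fun a) f = norm_\<Phi> \<Phi> (\<lambda>x. of_real_fun a x * f x + z * f x)"
proof -
  have "(\<lambda>x. of_real_fun a x * f x + z * f x) \<in> IC"
    by (intro L2.add_mem L2.scale_mem full.mult_mem assms)
  then show ?thesis
    unfolding graph_norm_\<Phi>_def full.nm_shift[OF assms, symmetric] using L2.nm_ge0 by simp
qed

text \<open>To reach \<open>p\<close>, approximate \<open>p / (a + z)\<close>, which the ideal property puts in \<open>IC\<close>, in the graph norm.\<close>

lemma dense_range_of_graph_closure:
  assumes cl: "graph_closure = IC" and z: "z = \<i> \<or> z = - \<i>"
  shows "op.dense_range z"
  unfolding op.dense_range_def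
proof (intro ballI allI impI)
  fix p and \<epsilon> :: real assume p: "p \<in> B" and \<epsilon>: "0 < \<epsilon>"
  let ?g = "\<lambda>x. p x / (of_real_fun a x + z)"
  have g: "?g \<in> IC" by (rule resolvent_IC(1)[OF z B_IC[OF p]])
  then have "?g \<in> graph_closure" using cl by simp
  then obtain c where c: "c \<in> B" "graph_norm_\<Phi> \<Phi> (of_real_fun a) (\<lambda>x. ?g x - c x) < \<epsilon>"
    using \<epsilon> by (rule seminorm_closureE)
  have "(\<lambda>x. of_real_fun a x * (?g x - c x) + z * (?g x - c x))
      = (\<lambda>x. p x - (of_real_fun a x * c x + z * c x))"
  proof
    fix x
    have "of_real_fun a x * (?g x - c x) + z * (?g x - c x)
        = (of_real_fun a x + z) * ?g x - (of_real_fun a x * c x + z * c x)"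
      by (simp only: distrib_right right_diff_distrib) simp
    then show "of_real_fun a x * (?g x - c x) + z * (?g x - c x)
        = p x - (of_real_fun a x * c x + z * c x)"
      using shift_nonzero[OF z, of x] by simp
  qed
  then have "norm_\<Phi> \<Phi> (\<lambda>x. p x - (of_real_fun a x * c x + z * c x)) < \<epsilon>"
    using c graph_norm_eq[OF L2.diff_mem[OF g B_IC[OF c(1)]] z] by simp
  then show "\<exists>c\<in>B. norm_\<Phi> \<Phi> (\<lambda>x. p x - (of_real_fun a x * c x + z * c x)) < \<epsilon>"
    using c(1) by (rule bexI)
qed

text \<open>To approximate \<open>f\<close> in the graph norm, approximate \<open>(a + \<i>) f\<close> in norm: by an element of \<open>B\<close>,
  and that by an element of the range of \<open>a + \<i>\<close>.\<close>

lemma graph_closure_of_dense_range: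
  assumes cl: "L2_closure = IC" and d: "op.dense_range \<i>"
  shows "graph_closure = IC"
proof (rule seminorm_closure_eqI)
  fix f and \<epsilon> :: real assume f: "f \<in> IC" and "0 < \<epsilon>"
  then have e: "0 < \<epsilon> / 2" by simp
  let ?s = "\<lambda>f x. of_real_fun a x * f x + \<i> * f x"
  have sI: "?s g \<in> IC" if "g \<in> IC" for g
    by (intro L2.add_mem L2.scale_mem full.mult_mem that)
  have "?s f \<in> L2_closure" using cl sI[OF f] by simp
  then obtain p where p: "p \<in> B" "norm_\<Phi> \<Phi> (\<lambda>x. ?s f x - p x) < \<epsilon> / 2"
    using e by (rule seminorm_closureE)
  obtain c where c: "c \<in> B" "norm_\<Phi> \<Phi> (\<lambda>x. p x - ?s c x) < \<epsilon> / 2"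
    using d p(1) e by (rule op.dense_rangeE)
  have "norm_\<Phi> \<Phi> (\<lambda>x. ?s f x - ?s c x) < \<epsilon>"
    using L2.nm_diff_triangle[OF sI[OF f] B_IC[OF p(1)] sI[OF B_IC[OF c(1)]]] p(2) c(2) by linarith
  moreover have "(\<lambda>x. ?s f x - ?s c x) = ?s (\<lambda>x. f x - c x)"
    by (simp add: fun_eq_iff algebra_simps)
  ultimately have "graph_norm_\<Phi> \<Phi> (of_real_fun a) (\<lambda>x. f x - c x) < \<epsilon>"
    using graph_norm_eq[OF L2.diff_mem[OF f B_IC[OF c(1)]], of \<i>] by simp
  then show "\<exists>b\<in>B. graph_norm_\<Phi> \<Phi> (of_real_fun a) (\<lambda>x. f x - b x) < \<epsilon>"
    using c(1) by (rule bexI)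
qed

text \<open>On the closure of \<open>B\<close> the resolvent of the operator is multiplication by \<open>1 / (a + z)\<close>, so that
  the closure is invariant under it. Concretely, if \<open>(a + z) c\<close> is near \<open>f\<close>, then \<open>c\<close> is at least
  as near to \<open>f / (a + z)\<close>, as \<open>1 \<le> \<bar>a + z\<bar>\<close>.\<close>

lemma resolvent_closure:
  assumes d: "op.dense_range z" and z: "z = \<i> \<or> z = - \<i>" and f: "f \<in> L2_closure"
  shows "(\<lambda>x. f x / (of_real_fun a x + z)) \<in> L2_closure"
proof -
  have fI: "f \<in> IC" using f by (simp add: seminorm_closure_def)
  let ?R = "\<lambda>f x. f x / (of_real_fun a x + z)"
  have "\<exists>c\<in>B. norm_\<Phi> \<Phi> (\<lambda>x. ?R f x - c x) < \<epsilon>" if "0 < \<epsilon>" for \<epsilon>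
  proof -
    have e: "0 < \<epsilon> / 2" using that by simp
    let ?s = "\<lambda>f x. of_real_fun a x * f x + z * f x"
    obtain b where b: "b \<in> B" "norm_\<Phi> \<Phi> (\<lambda>x. f x - b x) < \<epsilon> / 2"
      using f e by (rule seminorm_closureE)
    obtain c where c: "c \<in> B" "norm_\<Phi> \<Phi> (\<lambda>x. b x - ?s c x) < \<epsilon> / 2"
      using d b(1) e by (rule op.dense_rangeE)
    have sc: "?s c \<in> IC"
      by (intro L2.add_mem L2.scale_mem full.mult_mem B_IC c)
    have "norm_\<Phi> \<Phi> (\<lambda>x. f x - ?s c x) < \<epsilon>"
      using L2.nm_diff_triangle[OF fI B_IC[OF b(1)] sc] b(2) c(2) by linarith
    moreover have "(\<lambda>x. ?R f x - c x) = ?R (\<lambda>x. f x - ?s c x)"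
    proof
      fix x
      have "?s c x = (of_real_fun a x + z) * c x" by (simp add: distrib_right)
      then show "?R f x - c x = ?R (\<lambda>x. f x - ?s c x) x"
        using shift_nonzero[OF z, of x] by (simp add: diff_divide_distrib)
    qed
    ultimately have "norm_\<Phi> \<Phi> (\<lambda>x. ?R f x - c x) < \<epsilon>"
      using resolvent_IC(2)[OF z L2.diff_mem[OF fI sc]] by simp
    then show ?thesis using c(1) by (rule bexI)
  qed
  then show ?thesis using resolvent_IC(1)[OF z fI] by (simp add: seminorm_closure_def)
qed

text \<open>Up to constant factors these are the real and imaginary parts of the resolvent functions
  \<open>1 / (a \<plusminus> \<i>)\<close>. Together they determine \<open>a\<close>, which is their quotient.\<close>

lemma resolvent_multipliers:
  assumes dp: "op.dense_range \<i>" and dm: "op.dense_range (- \<i>)"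
  shows "(\<lambda>x. a x / (1 + (a x)\<^sup>2)) \<in> closed_subspace.multipliers L2_closure"
    and "(\<lambda>x. 1 / (1 + (a x)\<^sup>2)) \<in> closed_subspace.multipliers L2_closure"
proof -
  interpret cl: closed_subspace I \<Phi> L2_closure
    by (rule closed_subspace_closure[OF B_subspace B_subset])
  have pos: "0 < 1 + t\<^sup>2" for t :: real by (simp add: add_pos_nonneg)
  have parts: "(\<lambda>x. of_real (a x / (1 + (a x)\<^sup>2)) * f x) \<in> L2_closure"
    "(\<lambda>x. of_real (1 / (1 + (a x)\<^sup>2)) * f x) \<in> L2_closure" if f: "f \<in> L2_closure" for f
  proof -
    let ?R = "\<lambda>z x. f x / (of_real_fun a x + z)"
    have R: "?R \<i> \<in> L2_closure" "?R (- \<i>) \<in> L2_closure"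
      using resolvent_closure[OF dp _ f] resolvent_closure[OF dm _ f] by simp_all
    have eq: "1 / (complex_of_real t + \<i>) = of_real (t / (1 + t\<^sup>2)) - \<i> * of_real (1 / (1 + t\<^sup>2))"
      "1 / (complex_of_real t - \<i>) = of_real (t / (1 + t\<^sup>2)) + \<i> * of_real (1 / (1 + t\<^sup>2))" for t
      using pos[of t] by (simp_all add: complex_eq_iff Re_divide Im_divide add.commute
          power2_eq_square[of "1 + t\<^sup>2"])
    have "(\<lambda>x. (1/2) * (?R \<i> x + ?R (- \<i>) x)) \<in> L2_closure"
      by (intro cl.N_add cl.N_scale R)
    moreover have "(1/2) * (?R \<i> x + ?R (- \<i>) x) = of_real (a x / (1 + (a x)\<^sup>2)) * f x" for x
    proof -
      have "(1/2) * (?R \<i> x + ?R (- \<i>) x) = (1/2) * (1 / (of_real (a x) + \<i>) + 1 / (of_real (a x) - \<i>)) * f x"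
        by (simp add: of_real_fun_def algebra_simps)
      then show ?thesis unfolding eq by simp
    qed
    ultimately show "(\<lambda>x. of_real (a x / (1 + (a x)\<^sup>2)) * f x) \<in> L2_closure" by (simp only:)
    have "(\<lambda>x. (\<i>/2) * (?R \<i> x + (-1) * ?R (- \<i>) x)) \<in> L2_closure"
      by (intro cl.N_add cl.N_scale R)
    moreover have "(\<i>/2) * (?R \<i> x + (-1) * ?R (- \<i>) x) = of_real (1 / (1 + (a x)\<^sup>2)) * f x" for x
    proof -
      have "(\<i>/2) * (?R \<i> x + (-1) * ?R (- \<i>) x) = (\<i>/2) * (1 / (of_real (a x) + \<i>) - 1 / (of_real (a x) - \<i>)) * f x"
        by (simp add: of_real_fun_def algebra_simps)
      then show ?thesis unfolding eq by (simp add: algebra_simps)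
    qed
    ultimately show "(\<lambda>x. of_real (1 / (1 + (a x)\<^sup>2)) * f x) \<in> L2_closure" by (simp only:)
  qed
  have nz: "\<forall>x\<in>UNIV. 1 + (a x)\<^sup>2 \<noteq> 0" using pos by (metis less_irrefl)
  have cont: "continuous_on UNIV (\<lambda>x. a x / (1 + (a x)\<^sup>2))" "continuous_on UNIV (\<lambda>x. 1 / (1 + (a x)\<^sup>2))"
    by (intro continuous_on_divide continuous_on_add continuous_on_power continuous_on_const
        I_cont[OF a_mem] nz)+
  have "\<bar>t\<bar> \<le> 1 + t\<^sup>2" for t :: real
  proof -
    have "2 * \<bar>t\<bar> \<le> 1 + t\<^sup>2" using zero_le_power2[of "\<bar>t\<bar> - 1"] by (simp add: power2_diff)
    then show ?thesis using abs_ge_zero[of t] by linarith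
  qed
  then have bound: "\<bar>a x / (1 + (a x)\<^sup>2)\<bar> \<le> 1" "\<bar>1 / (1 + (a x)\<^sup>2)\<bar> \<le> 1" for x
    using pos[of "a x"] by (simp_all add: abs_divide)
  show "(\<lambda>x. a x / (1 + (a x)\<^sup>2)) \<in> cl.multipliers"
    unfolding cl.multipliers_def mem_Collect_eq by (intro conjI exI[of _ "1::real"] allI ballI cont bound parts)
  show "(\<lambda>x. 1 / (1 + (a x)\<^sup>2)) \<in> cl.multipliers"
    unfolding cl.multipliers_def mem_Collect_eq by (intro conjI exI[of _ "1::real"] allI ballI cont bound parts)
qed

end

section \<open>The equivalence and the density\<close>

theorem theorem6p4:
  fixes I A S :: "('a::t2_space \<Rightarrow> real) set"
    and \<Phi> :: "('a \<Rightarrow> real) \<Rightarrow> real"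
  assumes "Lindelof_space (euclidean :: 'a topology)"
    and "locally_compact_space (euclidean :: 'a topology)"
    and "riesz_ideal I" and "unital_subalgebra I"
    and "positive_linear_on I \<Phi>" and "strictly_continuous_on I \<Phi>"
    and "unital_subalgebra A" and "A \<subseteq> I"
    and "S \<subseteq> A" and "point_separating S"
  shows
    "((\<forall>a\<in>S. seminorm_closure (graph_norm_\<Phi> \<Phi> (of_real_fun a)) (complexification I) (complex_span A)
               = complexification I)
      \<longleftrightarrow>
      (\<forall>a\<in>S. essentially_selfadjoint (gns_space \<Phi> (complex_span A))
               (gns_operator \<Phi> (complex_span A) (of_real_fun a))))
     \<and>
     ((\<forall>a\<in>S. seminorm_closure (graph_norm_\<Phi> \<Phi> (of_real_fun a)) (complexification I) (complex_span A)
               = complexification I)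
      \<or>
      (\<forall>a\<in>S. essentially_selfadjoint (gns_space \<Phi> (complex_span A))
               (gns_operator \<Phi> (complex_span A) (of_real_fun a)))
      \<longrightarrow>
      seminorm_closure (norm_\<Phi> \<Phi>) (complexification I) (complex_span A) = complexification I)"
    (is "((\<forall>a\<in>S. ?graph a) \<longleftrightarrow> (\<forall>a\<in>S. ?sa a)) \<and> (_ \<longrightarrow> ?cl = _)")
proof -
  interpret daniell I \<Phi> by unfold_locales fact+
  have A: "fun_subspace A" using assms(7) by (simp add: unital_subalgebra_def)
  have A_mult: "(\<lambda>x. f x * g x) \<in> A" if "f \<in> A" "g \<in> A" for f g
    using assms(7) that by (simp add: unital_subalgebra_def)
  define B where "B = complex_span A"
  have B: "B = complexification A" unfolding B_def by (rule complex_span_eq_complexification[OF A])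
  have B_subspace: "fun_subspace B" unfolding B by (rule fun_subspace_complexification[OF A])
  have B_subset: "B \<subseteq> IC" using assms(8) by (auto simp: B complexification_iff)
  have op: "multiplication_operator I \<Phi> B a" if "a \<in> S" for a
  proof unfold_locales
    have a: "a \<in> A" using that assms(9) by blast
    then show "a \<in> I" using assms(8) by blast
    show "(\<lambda>x. of_real_fun a x * f x) \<in> B" if "f \<in> B" for f
      using that A_mult[OF a] by (simp add: B complexification_iff of_real_fun_def)
  qed (rule B_subspace B_subset)+
  have sa_iff: "?sa a \<longleftrightarrow> symmetric_operator.dense_range \<Phi> B (of_real_fun a) \<i>
      \<and> symmetric_operator.dense_range \<Phi> B (of_real_fun a) (- \<i>)" if "a \<in> S" for a
  proof -
    interpret multiplication_operator I \<Phi> B a by (rule op[OF that])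
    show ?thesis using op.essentially_selfadjoint_iff_dense_range unfolding B_def .
  qed
  have graph_sa: "?sa a" if "a \<in> S" "?graph a" for a
  proof -
    interpret multiplication_operator I \<Phi> B a by (rule op[OF that(1)])
    show ?thesis
      using dense_range_of_graph_closure that(2) unfolding sa_iff[OF that(1)] B_def by simp
  qed
  have L2_closure: "?cl = IC" if sa: "\<forall>a\<in>S. ?sa a"
  proof -
    interpret cl: closed_subspace I \<Phi> ?cl
      by (rule closed_subspace_closure[OF B_subspace[unfolded B_def] B_subset[unfolded B_def]])
    show ?thesis
    proof (rule cl.N_eq_IC[OF assms(1,2)])
      have "(\<lambda>x. 1) \<in> B"
        using assms(7) A by (simp add: B complexification_iff unital_subalgebra_def fun_subspace_def)
      moreover have "(\<lambda>x. 1) \<in> IC" using B_subset calculation by blast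
      ultimately show "(\<lambda>x. 1) \<in> ?cl"
        unfolding seminorm_closure_def B_def using L2.nm_zero by force
      fix x y :: 'a assume "x \<noteq> y"
      then obtain a where a: "a \<in> S" and ne: "a x \<noteq> a y"
        using assms(10) unfolding point_separating_def by blast
      interpret multiplication_operator I \<Phi> B a by (rule op[OF a])
      \<comment> \<open>The quotient of the two multipliers is \<open>a\<close>, so one of them separates \<open>x\<close> and \<open>y\<close>.\<close>
      have m: "(\<lambda>x. a x / (1 + (a x)\<^sup>2)) \<in> cl.multipliers" "(\<lambda>x. 1 / (1 + (a x)\<^sup>2)) \<in> cl.multipliers"
        using resolvent_multipliers sa_iff[OF a] sa a unfolding B_def by simp_all
      have "1 + (a t)\<^sup>2 \<noteq> 0" for t by (smt (verit) zero_le_power2)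
      then have "a t = (a t / (1 + (a t)\<^sup>2)) / (1 / (1 + (a t)\<^sup>2))" for t by simp
      then have "a x / (1 + (a x)\<^sup>2) \<noteq> a y / (1 + (a y)\<^sup>2) \<or> 1 / (1 + (a x)\<^sup>2) \<noteq> 1 / (1 + (a y)\<^sup>2)"
        using ne by metis
      then show "\<exists>h\<in>cl.multipliers. h x \<noteq> h y"
        using bexI[OF _ m(1), of "\<lambda>h. h x \<noteq> h y"] bexI[OF _ m(2), of "\<lambda>h. h x \<noteq> h y"] by blast
    qed
  qed
  have sa_graph: "?graph a" if sa: "\<forall>a\<in>S. ?sa a" and a: "a \<in> S" for a
  proof -
    interpret multiplication_operator I \<Phi> B a by (rule op[OF a])
    show ?thesis
      using graph_closure_of_dense_range L2_closure[OF sa] sa_iff[OF a] sa a unfolding B_def by simp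
  qed
  show ?thesis using graph_sa sa_graph L2_closure by blast
qed

end
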